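(* Let $k\ge 1$ and $d$ be positive integers with $d\ge k$, and let $\sigma\in S_k$. If $d>\sqrt{6}\,k^{7/4}$, then $$\frac{1}{1-\frac{k-1}{d^2}}\;\le\;\frac{(-1)^{|\sigma|}\,d^{k+|\sigma|}\,\mathrm{Wg}^{\mathrm{U}}(\sigma,d)}{\#P(\sigma,|\sigma|)}\;\le\;\frac{1}{1-\frac{6k^{7/2}}{d^2}}.$$ Moreover, the left-hand inequality holds for every integer $d\ge k$.
   Context: For integers $d\ge k\ge 1$ and $\sigma\in S_k$, the unitary Weingarten function is $\mathrm{Wg}^{\mathrm{U}}(\sigma,d)=\int_{\mathrm{U}(d)} u_{11}u_{22}\cdots u_{kk}\,\overline{u_{\sigma(1)1}u_{\sigma(2)2}\cdots u_{\sigma(k)k}}\,d\mu(U)$, where $\mu$ is the normalized Haar measure on the unitary group $\mathrm{U}(d)$ and $u_{ij}$ are the matrix entries of $U$. For $\sigma\in S_k$, $|\sigma|=k-(\text{number of cycles of }\sigma)$. The unitary Weingarten graph is the directed graph with vertex set $\bigsqcup_{k\ge0}S_k$ ($S_0=\{\emptyset\}$; vertices in $S_k$ have level $k$), with a solid arrow $\sigma\to(i,k)\sigma$ for each $\sigma\in S_k$, $k\ge2$, and each $1\le i<k$ (here $(i,k)$ is a transposition), and a dashed arrow $\sigma\dashrightarrow\sigma^{\downarrow}$ whenever $\sigma\in S_k$, $k\ge1$, satisfies $\sigma(k)=k$, where $\sigma^{\downarrow}\in S_{k-1}$ is the restriction of $\sigma$ to $\{1,\dots,k-1\}$. For $\sigma\in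 S_k$ and $l\ge0$, $P(\sigma,l)$ is the set of paths $(\sigma_0=\sigma,\sigma_1,\dots,\sigma_{l+k}=\emptyset)$ in which each consecutive pair is joined by an arrow $\sigma_{i-1}\to\sigma_i$ or $\sigma_{i-1}\dashrightarrow\sigma_i$; such a path uses exactly $k$ dashed and $l$ solid arrows. *)

theory Defs
  imports "HOL-Analysis.Analysis" "HOL-Combinatorics.Combinatorics"
begin

subsection \<open>Haar measure on the unitary group and the Weingarten function\<close>

definition adjoint_matrix :: "complex^'n^'m \<Rightarrow> complex^'m^'n" where
  "adjoint_matrix U = (\<chi> i j. cnj (U $ j $ i))"

definition unitary_group :: "(complex^'d^'d) set" where
  "unitary_group = {U. adjoint_matrix U ** U = mat 1 \<and> U ** adjoint_matrix U = mat 1}"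

text \<open>
  A left-invariant Borel probability measure on \<open>U(d)\<close>, where \<open>d = CARD('d)\<close>. Since \<open>U(d)\<close> is a
  compact metrizable group, such a measure exists, is unique, is automatically regular, and is also
  right-invariant.
\<close>

definition normalized_haar_unitary :: "(complex^'d^'d) measure \<Rightarrow> bool" where
  "normalized_haar_unitary \<mu> \<longleftrightarrow>
     sets \<mu> = sets (restrict_space borel unitary_group) \<and>
     emeasure \<mu> (space \<mu>) = 1 \<and>
     (\<forall>g\<in>unitary_group. \<forall>A\<in>sets \<mu>. emeasure \<mu> ((\<lambda>U. g ** U) ` A) = emeasure \<mu> A)"

text \<open>
  The rows and columns of a matrix of type \<open>complex^'d^'d\<close> are indexed by the type \<open>'d\<close>. The
  argument \<open>e\<close> is an enumeration of \<open>'d\<close> by \<open>{1..d}\<close>, so that the entry \<open>u\<^sub>i\<^sub>j\<close>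
  is \<open>U $ e i $ e j\<close>. A permutation in \<open>S\<^sub>k\<close> is a function \<open>\<sigma>\<close> with \<open>\<sigma> permutes {1..k}\<close>.
\<close>

definition Wg_U ::
  "(complex^'d^'d) measure \<Rightarrow> (nat \<Rightarrow> 'd) \<Rightarrow> nat \<Rightarrow> (nat \<Rightarrow> nat) \<Rightarrow> complex" where
  "Wg_U \<mu> e k \<sigma> =
     (\<integral>U. (\<Prod>i=1..k. U $ e i $ e i) * cnj (\<Prod>i=1..k. U $ e (\<sigma> i) $ e i) \<partial>\<mu>)"

text \<open>Fixed points count as cycles.\<close>

definition num_cycles :: "nat \<Rightarrow> (nat \<Rightarrow> nat) \<Rightarrow> nat" where
  "num_cycles k \<sigma> = card (orbit \<sigma> ` {1..k})"

definition perm_norm :: "nat \<Rightarrow> (nat \<Rightarrow> nat) \<Rightarrow> nat" where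
  "perm_norm k \<sigma> = k - num_cycles k \<sigma>"

subsection \<open>The unitary Weingarten graph\<close>

text \<open>
  A vertex is a pair of a level \<open>k\<close> and a permutation \<open>\<sigma>\<close> of \<open>{1..k}\<close>; the only vertex of level
  \<open>0\<close> is \<open>(0, id)\<close>. As elements of \<open>S\<^sub>k\<close> are represented by functions on all of \<open>nat\<close> that fix
  every point outside \<open>{1..k}\<close>, the restriction to \<open>{1..k-1}\<close> of a \<open>\<sigma>\<close> with \<open>\<sigma> k = k\<close> is
  represented by the same function, at level \<open>k - 1\<close>.
\<close>

type_synonym wg_vertex = "nat \<times> (nat \<Rightarrow> nat)"

inductive solid_arrow :: "wg_vertex \<Rightarrow> wg_vertex \<Rightarrow> bool" where
  "\<sigma> permutes {1..k} \<Longrightarrow> 2 \<le> k \<Longrightarrow> 1 \<le> i \<Longrightarrow> i < k \<Longrightarrow>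
     solid_arrow (k, \<sigma>) (k, Transposition.transpose i k \<circ> \<sigma>)"

inductive dashed_arrow :: "wg_vertex \<Rightarrow> wg_vertex \<Rightarrow> bool" where
  "\<sigma> permutes {1..k} \<Longrightarrow> 1 \<le> k \<Longrightarrow> \<sigma> k = k \<Longrightarrow>
     dashed_arrow (k, \<sigma>) (k - 1, \<sigma>)"

definition wg_paths :: "nat \<Rightarrow> (nat \<Rightarrow> nat) \<Rightarrow> nat \<Rightarrow> wg_vertex list set" where
  "wg_paths k \<sigma> l =
     {p. length p = l + k + 1 \<and> hd p = (k, \<sigma>) \<and> last p = (0, id) \<and>
         successively (\<lambda>v w. solid_arrow v w \<or> dashed_arrow v w) p}"

end

theory Submission
  imports Defs "HOL-Computational_Algebra.Formal_Power_Series"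
begin

text \<open>
  Left invariance of the Haar measure and unitarity give the orthogonality relation
  \<open>d Wg(\<sigma>) = [\<sigma>(k) = k] Wg(\<sigma>\<^sup>\<down>) - \<Sum>\<^sub>i Wg((i k) \<sigma>)\<close>, whose unique solution for \<open>d \<ge> k\<close> is
  \<open>\<Sum>\<^sub>l (-1)\<^sup>l #P(\<sigma>, l) d\<^sup>-\<^sup>k\<^sup>-\<^sup>l\<close>. A solid arrow changes \<open>|\<sigma>|\<close> by one, so only the lengths
  \<open>l = |\<sigma>| + 2 g\<close> occur, and the theorem follows from
  \<open>(k - 1)\<^sup>g #P(\<sigma>, |\<sigma>|) \<le> #P(\<sigma>, |\<sigma>| + 2 g) \<le> (6 k\<^sup>7\<^sup>/\<^sup>2)\<^sup>g #P(\<sigma>, |\<sigma>|)\<close> by summing geometric series.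
  The upper bound rests on \<open>#P(\<sigma>, |\<sigma>|)\<close> being a product of Catalan numbers over the cycles of \<open>\<sigma>\<close>, since
  an arrow increasing \<open>|\<sigma>|\<close> merges two cycles.
\<close>

subsection \<open>Orthogonality relations for the Haar integral\<close>

text \<open>Every surviving term of the series has the sign (-1)^|\<sigma>|, so there is no
  cancellation and termwise bounds on path counts pass directly to the Weingarten function.
  Convergence is needed down to \<open>d = k\<close>, where the upper bound on path counts is far
  too weak to give it. It comes from the recursion instead: a vertex of level \<open>k\<close> has
  only k - 1 < d outgoing solid arrows, so each solid step costs a factor below one after division
  by \<open>d\<close>. The same contraction gives uniqueness of the solution. The exponent 7/2 is 1
  + 1 + 3/2: the position of a norm-increasing step, the choice of that step, and the growth of the
  Catalan product when two cycles merge.\<close>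

lemma space_haar:
  assumes "normalized_haar_unitary \<mu>"
  shows "space \<mu> = unitary_group"
proof -
  have "sets \<mu> = sets (restrict_space borel unitary_group)"
    using assms unfolding normalized_haar_unitary_def by blast
  from sets_eq_imp_space_eq[OF this] show ?thesis
    by (simp add: space_restrict_space)
qed

lemma finite_measure_haar:
  assumes "normalized_haar_unitary \<mu>"
  shows "finite_measure \<mu>"
  using assms unfolding normalized_haar_unitary_def by (intro finite_measureI) simp

lemma measurable_haar:
  fixes f :: "complex^'d^'d \<Rightarrow> complex"
  assumes "normalized_haar_unitary \<mu>" "f \<in> borel_measurable borel"
  shows "f \<in> borel_measurable \<mu>"
proof -
  have "sets \<mu> = sets (restrict_space borel unitary_group)"
    using assms unfolding normalized_haar_unitary_def by blast
  then show ?thesis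
    using measurable_cong_sets measurable_restrict_space1[OF assms(2)] by blast
qed

lemma integrable_haar:
  fixes f :: "complex^'d^'d \<Rightarrow> complex"
  assumes "normalized_haar_unitary \<mu>" "f \<in> borel_measurable borel"
    and "\<And>U. U \<in> unitary_group \<Longrightarrow> norm (f U) \<le> B"
  shows "integrable \<mu> f"
proof -
  interpret finite_measure \<mu> by (rule finite_measure_haar[OF assms(1)])
  show ?thesis
    by (rule integrable_const_bound[where B = B])
      (auto simp: space_haar[OF assms(1)] assms(3) intro: measurable_haar[OF assms(1,2)])
qed

lemma adjoint_matrix_mult:
  fixes A :: "complex^'b^'a::finite" and B :: "complex^'c^'b::finite"
  shows "adjoint_matrix (A ** B) = adjoint_matrix B ** adjoint_matrix A"
  by (simp add: adjoint_matrix_def matrix_matrix_mult_def vec_eq_iff mult.commute)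

lemma adjoint_matrix_adjoint_matrix [simp]: "adjoint_matrix (adjoint_matrix A) = A"
  by (simp add: adjoint_matrix_def vec_eq_iff)

lemma unitary_group_mult:
  assumes "A \<in> unitary_group" "B \<in> unitary_group"
  shows "A ** B \<in> unitary_group"
proof -
  have "adjoint_matrix B ** adjoint_matrix A ** (A ** B)
      = adjoint_matrix B ** (adjoint_matrix A ** A) ** B"
    and "A ** B ** (adjoint_matrix B ** adjoint_matrix A)
      = A ** (B ** adjoint_matrix B) ** adjoint_matrix A"
    by (simp_all only: matrix_mul_assoc)
  then show ?thesis
    using assms by (simp add: unitary_group_def adjoint_matrix_mult)
qed

lemma unitary_group_adjoint: "A \<in> unitary_group \<Longrightarrow> adjoint_matrix A \<in> unitary_group"
  by (simp add: unitary_group_def)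

lemma borel_measurable_matrix_entry [measurable]:
  "(\<lambda>U::complex^'d::finite^'e::finite. U $ i $ j) \<in> borel_measurable borel"
  by (intro borel_measurable_continuous_onI continuous_intros)

lemma measurable_left_mult:
  fixes \<mu> :: "(complex^'d^'d::finite) measure"
  assumes "normalized_haar_unitary \<mu>" "g \<in> unitary_group"
  shows "(\<lambda>U. g ** U) \<in> measurable \<mu> \<mu>"
proof -
  have s: "sets \<mu> = sets (restrict_space borel unitary_group)"
    using assms unfolding normalized_haar_unitary_def by blast
  have "continuous_on UNIV (\<lambda>U::complex^'d^'d. g ** U)"
    unfolding matrix_matrix_mult_def by (intro continuous_intros)
  then have "(\<lambda>U::complex^'d^'d. g ** U) \<in> borel_measurable borel"
    by (rule borel_measurable_continuous_onI)
  then have "(\<lambda>U::complex^'d^'d. g ** U) \<in> borel_measurable (restrict_space borel unitary_group)"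
    by (rule measurable_restrict_space1)
  then have "(\<lambda>U::complex^'d^'d. g ** U) \<in> restrict_space borel unitary_group \<rightarrow>\<^sub>M restrict_space borel unitary_group"
    by (intro measurable_restrict_space2)
      (auto simp: space_restrict_space unitary_group_mult assms)
  then show ?thesis
    using measurable_cong_sets[OF s s] by blast
qed

text \<open>Invariance is postulated for images of sets, whereas a push-forward measures preimages.
  The preimage under \<open>g\<close> is the image under \<open>adjoint_matrix g\<close>, which is
  again unitary.\<close>

lemma haar_distr_left_mult:
  fixes \<mu> :: "(complex^'d^'d::finite) measure"
  assumes h: "normalized_haar_unitary \<mu>" and g: "g \<in> unitary_group"
  shows "distr \<mu> \<mu> (\<lambda>U. g ** U) = \<mu>"
proof (rule measure_eqI)
  fix A assume "A \<in> sets (distr \<mu> \<mu> (\<lambda>U. g ** U))"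
  then have A: "A \<in> sets \<mu>" by simp
  have sub: "A \<subseteq> unitary_group"
    using sets.sets_into_space[OF A] by (simp add: space_haar[OF h])
  have inv: "adjoint_matrix g ** g = mat 1" "g ** adjoint_matrix g = mat 1"
    using g by (auto simp: unitary_group_def)
  have "(\<lambda>U. g ** U) -` A \<inter> space \<mu> = (\<lambda>U. adjoint_matrix g ** U) ` A"
  proof (intro set_eqI iffI)
    fix U assume "U \<in> (\<lambda>U. g ** U) -` A \<inter> space \<mu>"
    moreover have "U = adjoint_matrix g ** (g ** U)"
      by (simp add: matrix_mul_assoc inv)
    ultimately show "U \<in> (\<lambda>U. adjoint_matrix g ** U) ` A"
      by blast
  next
    fix U assume "U \<in> (\<lambda>U. adjoint_matrix g ** U) ` A"
    then obtain V where V: "V \<in> A" "U = adjoint_matrix g ** V" by blast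
    then have "g ** U = V" by (simp add: matrix_mul_assoc inv)
    then show "U \<in> (\<lambda>U. g ** U) -` A \<inter> space \<mu>"
      using V sub unitary_group_mult[OF unitary_group_adjoint[OF g]] by (auto simp: space_haar[OF h])
  qed
  then have "emeasure (distr \<mu> \<mu> (\<lambda>U. g ** U)) A = emeasure \<mu> ((\<lambda>U. adjoint_matrix g ** U) ` A)"
    by (simp add: emeasure_distr[OF measurable_left_mult[OF h g] A])
  also have "\<dots> = emeasure \<mu> A"
    using h unitary_group_adjoint[OF g] A by (simp add: normalized_haar_unitary_def)
  finally show "emeasure (distr \<mu> \<mu> (\<lambda>U. g ** U)) A = emeasure \<mu> A" .
qed simp

lemma haar_integral_left_mult:
  fixes \<mu> :: "(complex^'d^'d::finite) measure" and f :: "complex^'d^'d \<Rightarrow> complex"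
  assumes h: "normalized_haar_unitary \<mu>" and g: "g \<in> unitary_group"
    and f: "f \<in> borel_measurable borel"
  shows "(\<integral>U. f (g ** U) \<partial>\<mu>) = (\<integral>U. f U \<partial>\<mu>)"
  using integral_distr[OF measurable_left_mult[OF h g] measurable_haar[OF h f]]
  by (simp add: haar_distr_left_mult[OF h g])

lemma unitary_entry_bound:
  fixes U :: "complex^'d^'d::finite"
  assumes "U \<in> unitary_group"
  shows "norm (U $ i $ j) \<le> 1"
proof -
  have "(adjoint_matrix U ** U) $ j $ j = 1"
    using assms by (simp add: unitary_group_def mat_def)
  then have "(\<Sum>l\<in>UNIV. complex_of_real ((norm (U $ l $ j))\<^sup>2)) = 1"
    by (simp add: adjoint_matrix_def matrix_matrix_mult_def complex_norm_square mult.commute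
        del: of_real_power)
  then have "(\<Sum>l\<in>UNIV. (norm (U $ l $ j))\<^sup>2) = 1"
    by (metis of_real_eq_1_iff of_real_sum)
  moreover have "(norm (U $ i $ j))\<^sup>2 \<le> (\<Sum>l\<in>UNIV. (norm (U $ l $ j))\<^sup>2)"
    by (rule member_le_sum) auto
  ultimately show ?thesis
    by (simp add: power_le_one_iff)
qed

lemma unitary_columns_orthonormal:
  fixes U :: "complex^'d^'d::finite"
  assumes "U \<in> unitary_group"
  shows "(\<Sum>r\<in>UNIV. U $ r $ a * cnj (U $ r $ b)) = (if a = b then 1 else 0)"
proof -
  have "(adjoint_matrix U ** U) $ b $ a = (mat 1 :: complex^'d^'d) $ b $ a"
    using assms by (simp add: unitary_group_def)
  then show ?thesis
    by (auto simp: adjoint_matrix_def matrix_matrix_mult_def mat_def mult.commute)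
qed

section \<open>Unitary matrices mixing two rows\<close>

text \<open>The identity matrix with a 2 x 2 block placed on the coordinates \<open>r\<close> and
  \<open>s\<close>. Invariance is applied only to such matrices: a swap of two rows and a family of
  Hadamard-like rotations.\<close>

definition row_op ::
  "'d \<Rightarrow> 'd \<Rightarrow> complex \<Rightarrow> complex \<Rightarrow> complex \<Rightarrow> complex \<Rightarrow> complex^'d^'d" where
  "row_op r s \<alpha> \<beta> \<gamma> \<delta> = (\<chi> i j.
     if i = r then (if j = r then \<alpha> else 0) + (if j = s then \<beta> else 0)
     else if i = s then (if j = r then \<gamma> else 0) + (if j = s then \<delta> else 0)
     else if i = j then 1 else 0)"

lemma row_op_mult:
  fixes U :: "complex^'d^'d::finite"
  shows "(row_op r s \<alpha> \<beta> \<gamma> \<delta> ** U) $ i $ j =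
    (if i = r then \<alpha> * U $ r $ j + \<beta> * U $ s $ j
     else if i = s then \<gamma> * U $ r $ j + \<delta> * U $ s $ j else U $ i $ j)"
  by (simp add: row_op_def matrix_matrix_mult_def distrib_right sum.distrib
      if_distrib[where f = "\<lambda>x. x * y" for y] cong: if_cong)

lemma row_op_unitary:
  fixes r s :: "'d::finite"
  assumes "r \<noteq> s" and "\<alpha> * cnj \<alpha> + \<beta> * cnj \<beta> = 1" and "\<gamma> * cnj \<gamma> + \<delta> * cnj \<delta> = 1"
    and "\<alpha> * cnj \<gamma> + \<beta> * cnj \<delta> = 0"
  shows "row_op r s \<alpha> \<beta> \<gamma> \<delta> \<in> unitary_group"
proof -
  have adj: "adjoint_matrix (row_op r s \<alpha> \<beta> \<gamma> \<delta>) = row_op r s (cnj \<alpha>) (cnj \<gamma>) (cnj \<beta>) (cnj \<delta>)"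
    using assms(1) by (auto simp: adjoint_matrix_def row_op_def vec_eq_iff)
  have "cnj (\<alpha> * cnj \<gamma> + \<beta> * cnj \<delta>) = 0"
    using assms(4) by simp
  then have "\<gamma> * cnj \<alpha> + \<delta> * cnj \<beta> = 0"
    by (simp add: mult.commute)
  then have "row_op r s \<alpha> \<beta> \<gamma> \<delta> ** row_op r s (cnj \<alpha>) (cnj \<gamma>) (cnj \<beta>) (cnj \<delta>) = mat 1"
    using assms unfolding vec_eq_iff row_op_mult
    by (auto simp: row_op_def mat_def)
  then show ?thesis
    by (simp add: unitary_group_def adj matrix_left_right_inverse)
qed

lemma borel_measurable_cnj_entry [measurable]:
  "(\<lambda>U::complex^'d::finite^'e::finite. cnj (U $ i $ j)) \<in> borel_measurable borel"
  by (intro borel_measurable_continuous_onI continuous_intros)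

lemma row_op_swap_unitary:
  "r \<noteq> s \<Longrightarrow> row_op r s 0 1 1 0 \<in> unitary_group"
  by (rule row_op_unitary) auto

lemma row_op_hadamard_unitary:
  assumes "r \<noteq> s" "z * cnj z = 1" "h = complex_of_real (1 / sqrt 2)"
  shows "row_op r s h (z * h) h (- z * h) \<in> unitary_group"
proof -
  have "h * cnj h = complex_of_real (1 / sqrt 2 * (1 / sqrt 2))"
    by (simp only: assms(3) complex_cnj_complex_of_real of_real_mult)
  then have h: "h * cnj h = 1 / 2" by simp
  have "z * h * cnj (z * h) = (z * cnj z) * (h * cnj h)" by simp
  then have zh: "z * h * cnj (z * h) = 1 / 2" by (simp only: assms(2) h mult_1)
  then have zh': "z * h * cnj (- z * h) = - (1 / 2)" "- z * h * cnj (- z * h) = 1 / 2"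
    by simp_all
  show ?thesis
    by (rule row_op_unitary[OF assms(1)]; unfold h zh zh') simp_all
qed

text \<open>
  Rotating the rows \<open>r\<close> and \<open>s\<close> into \<open>(r + z s) / \<surd>2\<close> and \<open>(r - z s) / \<surd>2\<close> and averaging over the
  fourth roots of unity \<open>z\<close> leaves only the terms of degree zero in \<open>z\<close>.
\<close>

lemma haar_integral_repeated_row:
  fixes \<mu> :: "(complex^'d^'d::finite) measure" and S :: "complex^'d^'d \<Rightarrow> complex"
  assumes h: "normalized_haar_unitary \<mu>" and rs: "r \<noteq> s"
    and S [measurable]: "S \<in> borel_measurable borel"
    and bd: "\<And>U. U \<in> unitary_group \<Longrightarrow> norm (S U) \<le> 1"
    and loc: "\<And>U V. (\<And>i. i \<noteq> r \<Longrightarrow> i \<noteq> s \<Longrightarrow> U $ i = V $ i) \<Longrightarrow> S U = S V"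
  shows "(\<integral>U. S U * (U $ r $ a * U $ r $ b * cnj (U $ r $ c) * cnj (U $ r $ e)) \<partial>\<mu>) =
    (\<integral>U. S U * (U $ r $ a * U $ s $ b * cnj (U $ r $ c) * cnj (U $ s $ e)) \<partial>\<mu>) +
    (\<integral>U. S U * (U $ r $ a * U $ s $ b * cnj (U $ s $ c) * cnj (U $ r $ e)) \<partial>\<mu>)"
proof -
  define T where "T = (\<lambda>q1 q2 q3 q4 U.
    S U * (U $ q1 $ a * U $ q2 $ b * cnj (U $ q3 $ c) * cnj (U $ q4 $ e)))"
  define F where "F = (\<lambda>q1 q2 q3 q4. \<integral>U. T q1 q2 q3 q4 U \<partial>\<mu>)"
  have T_meas: "T q1 q2 q3 q4 \<in> borel_measurable borel" for q1 q2 q3 q4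
    unfolding T_def by measurable
  have T_int: "integrable \<mu> (T q1 q2 q3 q4)" for q1 q2 q3 q4
  proof (rule integrable_haar[OF h T_meas])
    fix U :: "complex^'d^'d" assume U: "U \<in> unitary_group"
    show "norm (T q1 q2 q3 q4 U) \<le> 1"
      unfolding T_def norm_mult complex_mod_cnj
      by (intro mult_le_one bd U unitary_entry_bound mult_nonneg_nonneg norm_ge_zero)
  qed
  have S_row_op: "S (row_op r s \<alpha> \<beta> \<gamma> \<delta> ** U) = S U" for \<alpha> \<beta> \<gamma> \<delta> U
    by (rule loc) (simp add: vec_eq_iff row_op_mult)
  have swap: "F (sw q1) (sw q2) (sw q3) (sw q4) = F q1 q2 q3 q4"
    if "sw = (\<lambda>q. if q = r then s else r)" "{q1, q2, q3, q4} \<subseteq> {r, s}" for sw q1 q2 q3 q4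
  proof -
    have "T q1 q2 q3 q4 (row_op r s 0 1 1 0 ** U) = T (sw q1) (sw q2) (sw q3) (sw q4) U" for U
      using that rs by (auto simp: T_def S_row_op row_op_mult)
    then show ?thesis
      using haar_integral_left_mult[OF h row_op_swap_unitary[OF rs] T_meas[of q1 q2 q3 q4]]
      by (simp add: F_def)
  qed
  define hh where "hh = complex_of_real (1 / sqrt 2)"
  define H where "H = (\<lambda>z. row_op r s hh (z * hh) hh (- z * hh))"
  have cnj_hh: "cnj hh = hh" by (simp add: hh_def)
  have "hh * hh = complex_of_real (1 / sqrt 2 * (1 / sqrt 2))"
    by (simp only: hh_def of_real_mult)
  then have hh2: "hh * hh = 1 / 2" by simp
  have TH: "T r r r r (H z ** U) = (1 / 4) * (S U *
     ((U $ r $ a + z * U $ s $ a) * (U $ r $ b + z * U $ s $ b)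
     * (cnj (U $ r $ c) + cnj z * cnj (U $ s $ c)) * (cnj (U $ r $ e) + cnj z * cnj (U $ s $ e))))"
    for z U
  proof -
    have "T r r r r (H z ** U) = (hh * hh) * (hh * hh) * (S U *
     ((U $ r $ a + z * U $ s $ a) * (U $ r $ b + z * U $ s $ b)
     * (cnj (U $ r $ c) + cnj z * cnj (U $ s $ c)) * (cnj (U $ r $ e) + cnj z * cnj (U $ s $ e))))"
      by (simp add: T_def H_def S_row_op row_op_mult cnj_hh algebra_simps)
    then show ?thesis by (simp add: hh2)
  qed
  have FH: "(\<integral>U. T r r r r (H z ** U) \<partial>\<mu>) = F r r r r" if "z * cnj z = 1" for z
    unfolding F_def H_def
    by (rule haar_integral_left_mult[OF h row_op_hadamard_unitary[OF rs that hh_def] T_meas])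
  have FHi: "integrable \<mu> (\<lambda>U. T r r r r (H z ** U))" if "z * cnj z = 1" for z
  proof -
    have g: "H z \<in> unitary_group"
      unfolding H_def by (rule row_op_hadamard_unitary[OF rs that hh_def])
    show ?thesis
      using integrable_distr[OF measurable_left_mult[OF h g], of "T r r r r"] T_int
      by (simp add: haar_distr_left_mult[OF h g])
  qed
  have "4 * F r r r r = (\<integral>U. T r r r r (H 1 ** U) + T r r r r (H \<i> ** U)
      + T r r r r (H (-1) ** U) + T r r r r (H (-\<i>) ** U) \<partial>\<mu>)"
    by (simp add: FHi FH)
  also have "\<dots> = (\<integral>U. T r r r r U + T s s s s U + T r s r s U + T r s s r U + T s r r s U
      + T s r s r U \<partial>\<mu>)"
  proof (intro Bochner_Integration.integral_cong refl)
    have ring: "(1/4) * (S * ((a + 1 * a') * (b + 1 * b') * (c + cnj 1 * c') * (e + cnj 1 * e')))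
      + (1/4) * (S * ((a + \<i> * a') * (b + \<i> * b') * (c + cnj \<i> * c') * (e + cnj \<i> * e')))
      + (1/4) * (S * ((a + (-1) * a') * (b + (-1) * b') * (c + cnj (-1) * c') * (e + cnj (-1) * e')))
      + (1/4) * (S * ((a + (-\<i>) * a') * (b + (-\<i>) * b') * (c + cnj (-\<i>) * c') * (e + cnj (-\<i>) * e')))
      = S * (a * b * c * e) + S * (a' * b' * c' * e') + S * (a * b' * c * e')
      + S * (a * b' * c' * e) + S * (a' * b * c * e') + S * (a' * b * c' * e)"
      for S a b c e a' b' c' e' :: complex
    proof -
      have i: "\<i> * \<i> = -1" by simp
      show ?thesis
        unfolding complex_cnj_i complex_cnj_minus complex_cnj_one using i by algebra
    qed
    show "T r r r r (H 1 ** U) + T r r r r (H \<i> ** U)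
      + T r r r r (H (-1) ** U) + T r r r r (H (-\<i>) ** U)
      = T r r r r U + T s s s s U + T r s r s U + T r s s r U + T s r r s U + T s r s r U" for U
      unfolding TH unfolding T_def by (rule ring)
  qed
  also have "\<dots> = F r r r r + F s s s s + F r s r s + F r s s r + F s r r s + F s r s r"
    by (simp add: F_def T_int)
  \<comment> \<open>The swap of \<open>r\<close> and \<open>s\<close> identifies the six surviving
    terms in pairs, so \<open>4 * F r r r r\<close> equals \<open>2 * F r r r r\<close> plus twice
    the two mixed integrals.\<close>
  finally have "2 * F r r r r = 2 * (F r s r s + F r s s r)"
    using swap[OF refl, of r r r r] swap[OF refl, of r s r s] swap[OF refl, of r s s r] rs by simp
  then have "F r r r r = F r s r s + F r s s r"
    by (simp only: mult_cancel_left zero_neq_numeral[symmetric] simp_thms)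
  then show ?thesis by (simp add: F_def T_def)
qed

section \<open>The recursion for the Weingarten function\<close>

text \<open>Reindexing the conjugated product by \<sigma> groups the entries by rows: the factor
  with index \<open>i\<close> depends on row \<open>e i\<close> alone. Row operations then touch
  only the factors of the rows involved.\<close>

lemma Wg_U_eq_integral_prod:
  fixes \<mu> :: "(complex^'a^'a) measure"
  assumes "\<sigma> permutes {1..k}"
  shows "Wg_U \<mu> e k \<sigma> = (\<integral>U. (\<Prod>i=1..k. U $ e i $ e i * cnj (U $ e i $ e (inv \<sigma> i))) \<partial>\<mu>)"
proof -
  have "(\<Prod>i=1..k. U $ e i $ e (inv \<sigma> i)) = (\<Prod>i=1..k. U $ e (\<sigma> i) $ e i)"
    for U :: "complex^'a^'a"
    by (subst prod.permute[OF assms]) (simp add: permutes_inverses[OF assms] o_def)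
  then show ?thesis
    by (simp add: Wg_U_def prod.distrib flip: cnj_prod)
qed

lemma Wg_U_0:
  assumes "normalized_haar_unitary \<mu>"
  shows "Wg_U \<mu> e 0 \<sigma> = 1"
proof -
  have "measure \<mu> (space \<mu>) = 1"
    using assms by (simp add: normalized_haar_unitary_def measure_def)
  then show ?thesis by (simp add: Wg_U_def)
qed

lemma transpose_comp_permutes:
  fixes k :: nat
  assumes "\<sigma> permutes {1..k}" "i \<in> {1..<k}"
  shows "Transposition.transpose i k \<circ> \<sigma> permutes {1..k}"
  by (rule permutes_compose[OF assms(1) permutes_swap_id]) (use assms(2) in auto)

lemma permutes_pred:
  fixes k :: nat
  assumes "\<sigma> permutes {1..k}" "\<sigma> k = k"
  shows "\<sigma> permutes {1..k - 1}"
proof (rule permutes_superset[OF assms(1)])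
  fix x assume "x \<in> {1..k} - {1..k - 1}"
  then have "x = k" by auto
  then show "\<sigma> x = x" using assms(2) by simp
qed

text \<open>Let the row of the last factor range over all rows \<open>r\<close>, which gives the
  integrals \<open>G r\<close>. Orthonormality of columns evaluates their sum. The d - k + 1 rows
  \<open>e j\<close> with \<open>j \<ge> k\<close> occur in no other factor and can be exchanged
  with row \<open>e k\<close>, so each gives Wg(\<sigma>). A row with \<open>j < k\<close> carries
  two pairs of entries, and \<open>haar_integral_repeated_row\<close> turns it into Wg(\<sigma>) +
  Wg((j k) \<sigma>). Altogether Wg(\<sigma>) occurs (k - 1) + (d - k + 1) = d times.\<close>

lemma Wg_U_orthogonality:
  fixes \<mu> :: "(complex^'d^'d::finite) measure"
  assumes h: "normalized_haar_unitary \<mu>" and e: "bij_betw e {1..d} (UNIV :: 'd set)"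
    and k: "1 \<le> k" "k \<le> d" and \<sigma>: "\<sigma> permutes {1..k}"
  shows "of_nat d * Wg_U \<mu> e k \<sigma> = (if \<sigma> k = k then Wg_U \<mu> e (k - 1) \<sigma> else 0)
    - (\<Sum>i\<in>{1..<k}. Wg_U \<mu> e k (Transposition.transpose i k \<circ> \<sigma>))"
proof -
  define \<rho> where "\<rho> = inv \<sigma>"
  define m where "m = (\<lambda>\<rho> i (U::complex^'d^'d). U $ e i $ e i * cnj (U $ e i $ e (\<rho> i)))"
  have m_meas [measurable]: "m \<rho> i \<in> borel_measurable borel" for \<rho> i
    unfolding m_def by measurable
  have m_bd: "norm (m \<rho> i U) \<le> 1" if "U \<in> unitary_group" for \<rho> i U
    unfolding m_def norm_mult complex_mod_cnj
    by (intro mult_le_one unitary_entry_bound that norm_ge_zero)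
  have m_loc: "m \<rho> i U = m \<rho> i V" if "U $ e i = V $ e i" for \<rho> i U V
    using that by (simp add: m_def)
  have prod_bd: "norm (\<Prod>i\<in>A. m \<rho> i U) \<le> 1" if "U \<in> unitary_group" for A \<rho> U
    unfolding prod_norm[symmetric] by (rule prod_le_1) (simp add: m_bd[OF that])
  have e_inj: "e i = e j \<longleftrightarrow> i = j" if "i \<in> {1..d}" "j \<in> {1..d}" for i j
    using bij_betw_imp_inj_on[OF e] that by (auto dest: inj_onD)
  have split_k: "{1..k} = insert k {1..<k}" using k by auto
  define G where "G = (\<lambda>r. \<integral>U. (\<Prod>i\<in>{1..<k}. m \<rho> i U) *
    (U $ r $ e k * cnj (U $ r $ e (\<rho> k))) \<partial>\<mu>)"
  have W: "Wg_U \<mu> e k \<sigma> = G (e k)"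
    unfolding Wg_U_eq_integral_prod[OF \<sigma>] G_def split_k
    by (simp add: m_def \<rho>_def mult_ac)
  have G_int: "integrable \<mu> (\<lambda>U. (\<Prod>i\<in>{1..<k}. m \<rho> i U) *
    (U $ r $ e k * cnj (U $ r $ e (\<rho> k))))" for r
  proof (rule integrable_haar[OF h])
    fix U :: "complex^'d^'d" assume U: "U \<in> unitary_group"
    show "norm ((\<Prod>i\<in>{1..<k}. m \<rho> i U) * (U $ r $ e k * cnj (U $ r $ e (\<rho> k)))) \<le> 1"
      unfolding norm_mult complex_mod_cnj
      by (intro mult_le_one prod_bd U unitary_entry_bound mult_nonneg_nonneg norm_ge_zero)
  qed measurable
  have \<rho>k: "e k = e (\<rho> k) \<longleftrightarrow> \<sigma> k = k"
  proof -
    have "\<rho> k \<in> {1..k}"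
      using permutes_in_image[OF permutes_inv[OF \<sigma>]] k by (simp add: \<rho>_def)
    then have "e k = e (\<rho> k) \<longleftrightarrow> \<rho> k = k" using e_inj[of k "\<rho> k"] k by auto
    also have "\<dots> \<longleftrightarrow> \<sigma> k = k"
      using permutes_inverses[OF \<sigma>] unfolding \<rho>_def by metis
    finally show ?thesis .
  qed
  have "(\<Sum>r\<in>UNIV. G r) = (\<integral>U. (\<Prod>i\<in>{1..<k}. m \<rho> i U) *
      (\<Sum>r\<in>UNIV. U $ r $ e k * cnj (U $ r $ e (\<rho> k))) \<partial>\<mu>)"
    unfolding G_def sum_distrib_left
    by (rule Bochner_Integration.integral_sum[symmetric]) (rule G_int)
  also have "\<dots> = (\<integral>U. (\<Prod>i\<in>{1..<k}. m \<rho> i U) * (if \<sigma> k = k then 1 else 0) \<partial>\<mu>)"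
    by (intro Bochner_Integration.integral_cong refl)
      (simp add: space_haar[OF h] unitary_columns_orthonormal \<rho>k)
  also have "\<dots> = (if \<sigma> k = k then Wg_U \<mu> e (k - 1) \<sigma> else 0)"
  proof (cases "\<sigma> k = k")
    case True
    have "\<sigma> permutes {1..k - 1}" by (rule permutes_pred[OF \<sigma> True])
    moreover have "{1..k - 1} = {1..<k}" using k by auto
    ultimately show ?thesis
      using True by (simp add: Wg_U_eq_integral_prod m_def \<rho>_def)
  qed simp
  finally have tot: "(\<Sum>r\<in>UNIV. G r) = (if \<sigma> k = k then Wg_U \<mu> e (k - 1) \<sigma> else 0)" .
  have high: "G (e j) = Wg_U \<mu> e k \<sigma>" if j: "j \<in> {k..d}" for j
  proof (cases "j = k")
    case False
    then have ne: "e j \<noteq> e k" using e_inj[of j k] j k by auto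
    have ne': "e i \<noteq> e j" "e i \<noteq> e k" if "i \<in> {1..<k}" for i
      using e_inj[of i j] e_inj[of i k] j k that by auto
    have "G (e k) = (\<integral>U. (\<Prod>i\<in>{1..<k}. m \<rho> i (row_op (e j) (e k) 0 1 1 0 ** U)) *
      ((row_op (e j) (e k) 0 1 1 0 ** U) $ e k $ e k
        * cnj ((row_op (e j) (e k) 0 1 1 0 ** U) $ e k $ e (\<rho> k))) \<partial>\<mu>)"
      unfolding G_def
      by (rule haar_integral_left_mult[OF h row_op_swap_unitary[OF ne], symmetric]) measurable
    also have "\<dots> = G (e j)"
    proof -
      have "(\<Prod>i\<in>{1..<k}. m \<rho> i (row_op (e j) (e k) 0 1 1 0 ** U)) = (\<Prod>i\<in>{1..<k}. m \<rho> i U)"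
        for U
        by (intro prod.cong refl m_loc) (simp add: vec_eq_iff row_op_mult ne')
      then show ?thesis
        using ne unfolding G_def by (simp add: row_op_mult)
    qed
    finally show ?thesis by (simp add: W)
  qed (simp add: W)
  have low: "G (e j) = Wg_U \<mu> e k \<sigma> + Wg_U \<mu> e k (Transposition.transpose j k \<circ> \<sigma>)" if j: "j \<in> {1..<k}" for j
  proof -
    have ne: "e j \<noteq> e k" using e_inj[of j k] j k by auto
    define S where "S = (\<lambda>U. \<Prod>i\<in>{1..<k} - {j}. m \<rho> i U)"
    have prod_split: "(\<Prod>i\<in>{1..<k}. f i) = f j * (\<Prod>i\<in>{1..<k} - {j}. f i)" for f :: "nat \<Rightarrow> complex"
      using j by (intro prod.remove) auto
    have \<tau>\<sigma>: "Transposition.transpose j k \<circ> \<sigma> permutes {1..k}"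
      by (rule transpose_comp_permutes[OF \<sigma> j])
    \<comment> \<open>Inversion moves the transposition to the other side, so exchanging the columns
      \<open>\<rho> j\<close> and \<open>\<rho> k\<close> of the conjugated entries amounts to
      multiplying \<sigma> by (j k) on the left.\<close>
    have inv: "inv (Transposition.transpose j k \<circ> \<sigma>) = \<rho> \<circ> Transposition.transpose j k"
      by (simp add: \<rho>_def o_inv_distrib permutes_bij[OF \<sigma>])
    have "G (e j) = (\<integral>U. S U * (U $ e j $ e j * U $ e j $ e k
        * cnj (U $ e j $ e (\<rho> j)) * cnj (U $ e j $ e (\<rho> k))) \<partial>\<mu>)"
      unfolding G_def prod_split S_def by (simp add: m_def mult_ac)
    also have "\<dots> = (\<integral>U. S U * (U $ e j $ e j * U $ e k $ e k
        * cnj (U $ e j $ e (\<rho> j)) * cnj (U $ e k $ e (\<rho> k))) \<partial>\<mu>) +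
       (\<integral>U. S U * (U $ e j $ e j * U $ e k $ e k
        * cnj (U $ e k $ e (\<rho> j)) * cnj (U $ e j $ e (\<rho> k))) \<partial>\<mu>)"
    proof (rule haar_integral_repeated_row[OF h ne])
      show "S \<in> borel_measurable borel" unfolding S_def by measurable
      show "norm (S U) \<le> 1" if "U \<in> unitary_group" for U
        unfolding S_def by (rule prod_bd[OF that])
      show "S U = S V" if "\<And>i. i \<noteq> e j \<Longrightarrow> i \<noteq> e k \<Longrightarrow> U $ i = V $ i" for U V
        unfolding S_def
      proof (intro prod.cong refl m_loc that)
        fix i assume "i \<in> {1..<k} - {j}"
        then show "e i \<noteq> e j" "e i \<noteq> e k"
          using e_inj[of i j] e_inj[of i k] j k by auto
      qed
    qed
    also have "(\<integral>U. S U * (U $ e j $ e j * U $ e k $ e k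
        * cnj (U $ e j $ e (\<rho> j)) * cnj (U $ e k $ e (\<rho> k))) \<partial>\<mu>) = Wg_U \<mu> e k \<sigma>"
      unfolding W G_def prod_split S_def by (simp add: m_def mult_ac)
    also have "(\<integral>U. S U * (U $ e j $ e j * U $ e k $ e k
        * cnj (U $ e k $ e (\<rho> j)) * cnj (U $ e j $ e (\<rho> k))) \<partial>\<mu>)
        = Wg_U \<mu> e k (Transposition.transpose j k \<circ> \<sigma>)"
    proof -
      have "(\<Prod>i\<in>{1..<k} - {j}. m (\<rho> \<circ> Transposition.transpose j k) i U) = S U" for U
        unfolding S_def by (rule prod.cong) (auto simp: m_def Transposition.transpose_def)
      then have "(\<Prod>i\<in>insert k {1..<k}. m (\<rho> \<circ> Transposition.transpose j k) i U) =
          m (\<rho> \<circ> Transposition.transpose j k) k U * (m (\<rho> \<circ> Transposition.transpose j k) j U * S U)"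
        for U
        by (subst prod.insert) (simp_all only: prod_split finite_atLeastLessThan, simp)
      then have "(\<Prod>i\<in>{1..k}. m (\<rho> \<circ> Transposition.transpose j k) i U) =
          S U * (U $ e j $ e j * U $ e k $ e k * cnj (U $ e k $ e (\<rho> j)) * cnj (U $ e j $ e (\<rho> k)))"
        for U
        by (simp only: split_k) (simp add: m_def mult_ac)
      then show ?thesis
        unfolding Wg_U_eq_integral_prod[OF \<tau>\<sigma>] inv by (simp add: m_def)
    qed
    finally show ?thesis .
  qed
  have "(\<Sum>r\<in>UNIV. G r) = (\<Sum>j\<in>{1..d}. G (e j))"
    by (rule sum.reindex_bij_betw[OF e, symmetric])
  also have "\<dots> = (\<Sum>j\<in>{1..<k}. G (e j)) + (\<Sum>j\<in>{k..d}. G (e j))"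
    using k by (subst sum.union_disjoint[symmetric]) (auto intro!: sum.cong)
  also have "\<dots> = of_nat d * Wg_U \<mu> e k \<sigma> + (\<Sum>i\<in>{1..<k}. Wg_U \<mu> e k (Transposition.transpose i k \<circ> \<sigma>))"
  proof -
    have "(\<Sum>j\<in>{1..<k}. G (e j)) = (\<Sum>j\<in>{1..<k}. Wg_U \<mu> e k \<sigma> + Wg_U \<mu> e k (Transposition.transpose j k \<circ> \<sigma>))"
      by (rule sum.cong) (use low in auto)
    moreover have "(\<Sum>j\<in>{k..d}. G (e j)) = (\<Sum>j\<in>{k..d}. Wg_U \<mu> e k \<sigma>)"
      by (rule sum.cong) (use high in auto)
    moreover have "of_nat d = (of_nat (k - 1) + of_nat (Suc d - k) :: complex)"
      using k by (simp flip: of_nat_add)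
    ultimately show ?thesis
      by (simp add: sum.distrib distrib_right)
  qed
  finally show ?thesis
    using tot by (simp add: algebra_simps)
qed

subsection \<open>Expansion over paths in the Weingarten graph\<close>

abbreviation wg_arrow :: "wg_vertex \<Rightarrow> wg_vertex \<Rightarrow> bool" where
  "wg_arrow v w \<equiv> solid_arrow v w \<or> dashed_arrow v w"

lemma wg_arrow_iff:
  assumes "\<sigma> permutes {1..k}" "1 \<le> k"
  shows "wg_arrow (k, \<sigma>) w \<longleftrightarrow> \<sigma> k = k \<and> w = (k - 1, \<sigma>) \<or>
    (\<exists>i\<in>{1..<k}. w = (k, Transposition.transpose i k \<circ> \<sigma>))"
proof
  assume "wg_arrow (k, \<sigma>) w"
  then show "\<sigma> k = k \<and> w = (k - 1, \<sigma>) \<or>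
    (\<exists>i\<in>{1..<k}. w = (k, Transposition.transpose i k \<circ> \<sigma>))"
    by (auto elim!: solid_arrow.cases dashed_arrow.cases)
next
  assume "\<sigma> k = k \<and> w = (k - 1, \<sigma>) \<or>
    (\<exists>i\<in>{1..<k}. w = (k, Transposition.transpose i k \<circ> \<sigma>))"
  then show "wg_arrow (k, \<sigma>) w"
    using assms solid_arrow.intros[of \<sigma> k] dashed_arrow.intros[of \<sigma> k] by auto
qed

text \<open>An arrow lowers the level by at most one. For \<open>l = 0\<close> this rules out a
  solid first arrow: the rest of the path would be too short to descend from level
  \<open>k\<close>.\<close>

lemma wg_path_length:
  assumes "successively wg_arrow p" "p \<noteq> []" "last p = (0, id)"
  shows "fst (hd p) < length p"
  using assms
proof (induction p)
  case (Cons v p)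
  show ?case
  proof (cases "p = []")
    case False
    then have "wg_arrow v (hd p)" "fst (hd p) < length p"
      using Cons by (auto simp: successively_Cons)
    moreover from this(1) have "fst v \<le> Suc (fst (hd p))"
      by (auto elim!: solid_arrow.cases dashed_arrow.cases)
    ultimately show ?thesis by simp
  qed (use Cons in simp)
qed simp

lemma wg_paths_0: "wg_paths 0 id l = (if l = 0 then {[(0, id)]} else {})"
proof -
  have "\<not> wg_arrow (0, id) w" for w
    by (auto elim!: solid_arrow.cases dashed_arrow.cases)
  then have "p = [(0, id)]" if "hd p = (0, id)" "p \<noteq> []" "successively wg_arrow p" for p
    using that by (cases p) (auto simp: successively_Cons)
  then show ?thesis
    unfolding wg_paths_def by (auto simp: length_Suc_conv)
qed

lemma wg_paths_rec:
  assumes "\<sigma> permutes {1..k}" "1 \<le> k"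
  shows "wg_paths k \<sigma> l = (#) (k, \<sigma>) ` ((if \<sigma> k = k then wg_paths (k - 1) \<sigma> l else {}) \<union>
    (\<Union>i\<in>{1..<k}. if l = 0 then {} else wg_paths k (Transposition.transpose i k \<circ> \<sigma>) (l - 1)))"
    (is "_ = (#) _ ` ?Q")
proof (intro set_eqI iffI)
  fix p assume p: "p \<in> wg_paths k \<sigma> l"
  then obtain q where q: "p = (k, \<sigma>) # q" "length q = l + k"
    unfolding wg_paths_def by (cases p) auto
  then have "q \<noteq> []" using assms(2) by auto
  then have q': "wg_arrow (k, \<sigma>) (hd q)" "successively wg_arrow q" "last q = (0, id)"
    using p q by (auto simp: wg_paths_def successively_Cons)
  then have len: "fst (hd q) < l + k"
    using wg_path_length[OF q'(2) \<open>q \<noteq> []\<close>] q(2) by simp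
  have "q \<in> ?Q"
    using q'(1) unfolding wg_arrow_iff[OF assms]
  proof (elim disjE conjE bexE)
    assume "\<sigma> k = k" "hd q = (k - 1, \<sigma>)"
    then show ?thesis using q(2) q' assms(2) by (simp add: wg_paths_def)
  next
    fix i assume i: "i \<in> {1..<k}" "hd q = (k, Transposition.transpose i k \<circ> \<sigma>)"
    then have "l > 0" using len by simp
    then show ?thesis using i q(2) q'
      by (intro UnI2 UN_I[of i]) (simp_all add: wg_paths_def)
  qed
  then show "p \<in> (#) (k, \<sigma>) ` ?Q" using q(1) by blast
next
  fix p assume "p \<in> (#) (k, \<sigma>) ` ?Q"
  then obtain q where q: "q \<in> ?Q" "p = (k, \<sigma>) # q" by blast
  from q(1) have "q \<noteq> [] \<and> length q = l + k \<and> last q = (0, id) \<and> successively wg_arrow q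
      \<and> wg_arrow (k, \<sigma>) (hd q)"
    unfolding wg_arrow_iff[OF assms] using assms(2)
    by (auto simp: wg_paths_def split: if_splits)
  then show "p \<in> wg_paths k \<sigma> l"
    using q(2) by (simp add: wg_paths_def successively_Cons)
qed

text \<open>Solid arrows stay on a level and dashed arrows leave it downwards. Arguments along paths
  therefore induct on the level outside and, where solid arrows must be followed, on the length or
  on |\<sigma>| inside.\<close>

lemma permutes_level_induct [consumes 1, case_names 0 step]:
  fixes k :: nat
  assumes "\<sigma> permutes {1..k}"
    and "P 0 id"
    and "\<And>k \<sigma>. 1 \<le> k \<Longrightarrow> \<sigma> permutes {1..k} \<Longrightarrow>
      (\<And>\<tau>. \<tau> permutes {1..k - 1} \<Longrightarrow> P (k - 1) \<tau>) \<Longrightarrow> P k \<sigma>"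
  shows "P k \<sigma>"
  using assms(1)
proof (induction k arbitrary: \<sigma>)
  case 0
  then have "\<sigma> = id" by simp
  then show ?case by (simp only: assms(2))
next
  case (Suc k)
  show ?case by (rule assms(3)) (use Suc in auto)
qed

lemma finite_wg_paths:
  assumes "\<sigma> permutes {1..k}"
  shows "finite (wg_paths k \<sigma> l)"
  using assms
proof (induction arbitrary: l rule: permutes_level_induct)
  case 0
  show ?case by (simp only: wg_paths_0) simp
next
  case (step k \<sigma>)
  from step(2) show ?case
  proof (induction l arbitrary: \<sigma>)
    case (0 \<sigma>)
    show ?case
      unfolding wg_paths_rec[OF 0 step(1)] using step(3)[OF permutes_pred[OF 0]] by simp
  next
    case (Suc l \<sigma>)
    have "finite (wg_paths k (Transposition.transpose i k \<circ> \<sigma>) l)" if "i \<in> {1..<k}" for i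
      by (rule Suc.IH[OF transpose_comp_permutes[OF Suc.prems that]])
    then show ?case
      unfolding wg_paths_rec[OF Suc.prems step(1)] using step(3)[OF permutes_pred[OF Suc.prems]]
      by simp
  qed
qed

definition num_paths :: "nat \<Rightarrow> (nat \<Rightarrow> nat) \<Rightarrow> nat \<Rightarrow> nat" where
  "num_paths k \<sigma> l = card (wg_paths k \<sigma> l)"

lemma num_paths_0: "num_paths 0 id l = (if l = 0 then 1 else 0)"
  by (simp add: num_paths_def wg_paths_0)

text \<open>At the point that \<sigma> sends to \<open>k\<close> the product has the value
  \<open>i\<close>. Hence the solid arrows from a vertex have distinct targets, and the paths
  through them are counted without overlap.\<close>

lemma transpose_comp_inj:
  assumes "Transposition.transpose i k \<circ> \<sigma> = Transposition.transpose j k \<circ> \<sigma>" "\<sigma> permutes A"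
  shows "i = j"
proof -
  obtain x where "\<sigma> x = k" using permutes_surj[OF assms(2)] by (metis surjD)
  then show ?thesis using fun_cong[OF assms(1), of x] by simp
qed

lemma num_paths_rec:
  assumes "\<sigma> permutes {1..k}" "1 \<le> k"
  shows "num_paths k \<sigma> l = (if \<sigma> k = k then num_paths (k - 1) \<sigma> l else 0) +
    (if l = 0 then 0 else \<Sum>i\<in>{1..<k}. num_paths k (Transposition.transpose i k \<circ> \<sigma>) (l - 1))"
proof -
  define A where "A = (if \<sigma> k = k then wg_paths (k - 1) \<sigma> l else {})"
  define B where "B = (\<lambda>i. if l = 0 then {}
    else wg_paths k (Transposition.transpose i k \<circ> \<sigma>) (l - 1))"
  have fin: "finite A" "\<And>i. i \<in> {1..<k} \<Longrightarrow> finite (B i)"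
    using assms permutes_pred transpose_comp_permutes by (auto simp: A_def B_def finite_wg_paths)
  have hdA: "hd q = (k - 1, \<sigma>)" if "q \<in> A" for q
    using that by (auto simp: A_def wg_paths_def split: if_splits)
  have hdB: "hd q = (k, Transposition.transpose i k \<circ> \<sigma>)" if "q \<in> B i" for q i
    using that by (auto simp: B_def wg_paths_def split: if_splits)
  have "A \<inter> (\<Union>i\<in>{1..<k}. B i) = {}"
    using hdA hdB assms(2) by fastforce
  moreover have "B i \<inter> B j = {}" if "i \<noteq> j" for i j
    using that hdB[of _ i] hdB[of _ j] transpose_comp_inj[OF _ assms(1), of i k j] by fastforce
  moreover have "num_paths k \<sigma> l = card (A \<union> (\<Union>i\<in>{1..<k}. B i))"
    unfolding num_paths_def wg_paths_rec[OF assms] A_def B_def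
    by (rule card_image) (simp add: inj_on_def)
  ultimately have "num_paths k \<sigma> l = card A + (\<Sum>i\<in>{1..<k}. card (B i))"
    using fin by (simp add: card_Un_disjoint card_UN_disjoint)
  then show ?thesis
    by (simp add: A_def B_def num_paths_def cong: if_cong)
qed

section \<open>Convergence and uniqueness of the path series\<close>

text \<open>A first step along a dashed arrow leads to the bound of the level below. A first step
  along one of the solid arrows leads to a shorter partial sum on the same level, divided by
  \<open>d\<close>; there are fewer than \<open>d\<close> of them.\<close>

lemma num_paths_partial_sums_bounded:
  assumes "k \<le> d"
  shows "\<exists>B. \<forall>\<sigma> L. \<sigma> permutes {1..k} \<longrightarrow> (\<Sum>l<L. real (num_paths k \<sigma> l) / real d ^ l) \<le> B"
  using assms
proof (induction k)
  case 0
  have "(\<Sum>l<L. real (num_paths 0 id l) / real d ^ l) \<le> 1" for L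
    unfolding num_paths_0 by (cases L) (simp_all add: sum.lessThan_Suc_shift del: sum.lessThan_Suc)
  then have "(\<Sum>l<L. real (num_paths 0 \<sigma> l) / real d ^ l) \<le> 1" if "\<sigma> permutes {1..0}" for \<sigma> L
  proof -
    have "\<sigma> = id" using that by simp
    with \<open>\<And>L. (\<Sum>l<L. real (num_paths 0 id l) / real d ^ l) \<le> 1\<close> show ?thesis by (simp only:)
  qed
  then show ?case by blast
next
  case (Suc k)
  then obtain B where B: "\<And>\<sigma> L. \<sigma> permutes {1..k} \<Longrightarrow>
    (\<Sum>l<L. real (num_paths k \<sigma> l) / real d ^ l) \<le> B" by auto
  have "B \<ge> 0" using B[OF permutes_id, of 0] by simp
  \<comment> \<open>The fixed point of C = B + (k / d) C, where \<open>k\<close> is the number of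
    solid arrows at level \<open>Suc k\<close>; it is finite and nonnegative because
    \<open>k < d\<close>.\<close>
  define C where "C = B / (1 - real k / real d)"
  have d: "real d > real k" "real d > 0" using Suc.prems by auto
  then have "C \<ge> 0" using \<open>B \<ge> 0\<close> by (simp add: C_def)
  have C: "B + real k / real d * C = C" using d by (simp add: C_def field_simps)
  have "(\<Sum>l<L. real (num_paths (Suc k) \<sigma> l) / real d ^ l) \<le> C" if "\<sigma> permutes {1..Suc k}" for \<sigma> L
    using that
  proof (induction L arbitrary: \<sigma>)
    case (Suc L)
    let ?s = "\<lambda>i. Transposition.transpose i (Suc k) \<circ> \<sigma>"
    let ?fix = "\<lambda>l. if \<sigma> (Suc k) = Suc k then real (num_paths k \<sigma> l) / real d ^ l else 0"
    have s0: "real (num_paths (Suc k) \<sigma> 0) / real d ^ 0 = ?fix 0"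
      by (simp add: num_paths_rec[OF Suc.prems])
    have sS: "real (num_paths (Suc k) \<sigma> (Suc l)) / real d ^ Suc l = ?fix (Suc l) +
      (\<Sum>i\<in>{1..<Suc k}. real (num_paths (Suc k) (?s i) l) / real d ^ l) / real d" for l
      by (subst num_paths_rec[OF Suc.prems])
        (simp_all add: add_divide_distrib sum_divide_distrib mult.commute)
    have "(\<Sum>l<Suc L. real (num_paths (Suc k) \<sigma> l) / real d ^ l) = (\<Sum>l<Suc L. ?fix l) +
      (\<Sum>l<L. (\<Sum>i\<in>{1..<Suc k}. real (num_paths (Suc k) (?s i) l) / real d ^ l) / real d)"
      by (simp only: sum.lessThan_Suc_shift s0 sS sum.distrib add.assoc)
    also have "(\<Sum>l<Suc L. ?fix l) \<le> B"
    proof (cases "\<sigma> (Suc k) = Suc k")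
      case True
      then have "\<sigma> permutes {1..k}" using permutes_pred[OF Suc.prems] by simp
      then show ?thesis using True B[of \<sigma> "Suc L"] by simp
    qed (simp add: \<open>B \<ge> 0\<close>)
    also have "(\<Sum>l<L. (\<Sum>i\<in>{1..<Suc k}. real (num_paths (Suc k) (?s i) l) / real d ^ l) / real d)
      = (\<Sum>i\<in>{1..<Suc k}. \<Sum>l<L. real (num_paths (Suc k) (?s i) l) / real d ^ l) / real d"
      by (simp only: sum_divide_distrib) (rule sum.swap)
    also have "\<dots> \<le> (\<Sum>i\<in>{1..<Suc k}. C) / real d"
      by (intro divide_right_mono sum_mono Suc.IH transpose_comp_permutes[OF Suc.prems]) auto
    also have "B + (\<Sum>i\<in>{1..<Suc k}. C) / real d = C" using C by simp
    finally show ?case by simp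
  qed (simp add: \<open>C \<ge> 0\<close>)
  then show ?case by blast
qed

definition path_series :: "nat \<Rightarrow> nat \<Rightarrow> (nat \<Rightarrow> nat) \<Rightarrow> nat \<Rightarrow> real" where
  "path_series d k \<sigma> l = (-1) ^ l * real (num_paths k \<sigma> l) / real d ^ (k + l)"

lemma summable_path_series:
  assumes "k \<le> d" "\<sigma> permutes {1..k}"
  shows "summable (path_series d k \<sigma>)"
proof -
  obtain B where "\<And>L. (\<Sum>l<L. real (num_paths k \<sigma> l) / real d ^ l) \<le> B"
    using num_paths_partial_sums_bounded[OF assms(1)] assms(2) by blast
  then have "summable (\<lambda>l. real (num_paths k \<sigma> l) / real d ^ l)"
    by (intro summableI_nonneg_bounded) auto
  then have "summable (\<lambda>l. real (num_paths k \<sigma> l) / real d ^ l / real d ^ k)"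
    by (rule summable_divide)
  then have "summable (\<lambda>l. norm (path_series d k \<sigma> l))"
    by (simp add: path_series_def abs_mult power_add mult.commute)
  then show ?thesis by (rule summable_norm_cancel)
qed

lemma suminf_path_series_rec:
  assumes "1 \<le> k" "k \<le> d" "\<sigma> permutes {1..k}"
  shows "real d * suminf (path_series d k \<sigma>) =
    (if \<sigma> k = k then suminf (path_series d (k - 1) \<sigma>) else 0)
    - (\<Sum>i\<in>{1..<k}. suminf (path_series d k (Transposition.transpose i k \<circ> \<sigma>)))"
proof -
  let ?s = "\<lambda>i. Transposition.transpose i k \<circ> \<sigma>"
  let ?fix = "\<lambda>l. if \<sigma> k = k then path_series d (k - 1) \<sigma> l else 0"
  \<comment> \<open>A solid arrow uses up one unit of \<open>l\<close>, so its series enters shifted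
    by one. The shift absorbs the factor \<open>d\<close> and produces the minus sign, while for a
    dashed arrow the drop of the level absorbs \<open>d\<close>.\<close>
  define H where "H = (\<lambda>l. case l of 0 \<Rightarrow> 0
    | Suc l \<Rightarrow> \<Sum>i\<in>{1..<k}. path_series d k (?s i) l)"
  have d: "real d > 0" using assms by simp
  have dk: "real d ^ k = real d * real d ^ (k - 1)" using assms(1) by (cases k) auto
  have "(\<lambda>l. \<Sum>i\<in>{1..<k}. path_series d k (?s i) l) sums
    (\<Sum>i\<in>{1..<k}. suminf (path_series d k (?s i)))"
    by (intro sums_sum summable_sums summable_path_series assms transpose_comp_permutes)
  then have "(\<lambda>l. H (Suc l)) sums (\<Sum>i\<in>{1..<k}. suminf (path_series d k (?s i)))"
    by (simp add: H_def)
  then have H: "H sums (\<Sum>i\<in>{1..<k}. suminf (path_series d k (?s i)))"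
    by (subst (asm) sums_Suc_iff) (simp add: H_def)
  have fx: "?fix sums (if \<sigma> k = k then suminf (path_series d (k - 1) \<sigma>) else 0)"
  proof (cases "\<sigma> k = k")
    case True
    then have "summable (path_series d (k - 1) \<sigma>)"
      using permutes_pred[OF assms(3)] assms(2) by (intro summable_path_series) auto
    then show ?thesis unfolding if_P[OF True] by (rule summable_sums)
  qed simp
  have "real d * path_series d k \<sigma> l = ?fix l - H l" for l
  proof (cases l)
    case 0
    then show ?thesis using d
      by (simp add: path_series_def H_def num_paths_rec[OF assms(3,1)] dk)
  next
    case (Suc l')
    show ?thesis using d unfolding Suc path_series_def
      by (subst num_paths_rec[OF assms(3,1)], cases "\<sigma> k = k")
        (simp_all add: H_def path_series_def dk power_add distrib_left add_divide_distrib
          diff_divide_distrib sum_divide_distrib sum_distrib_left sum_negf mult.assoc right_diff_distrib)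
  qed
  then have "(\<lambda>l. real d * path_series d k \<sigma> l) sums
    ((if \<sigma> k = k then suminf (path_series d (k - 1) \<sigma>) else 0)
      - (\<Sum>i\<in>{1..<k}. suminf (path_series d k (?s i))))"
    using sums_diff[OF fx H] by presburger
  moreover have "(\<lambda>l. real d * path_series d k \<sigma> l) sums (real d * suminf (path_series d k \<sigma>))"
    by (intro sums_mult summable_sums summable_path_series assms)
  ultimately show ?thesis by (simp add: sums_unique2)
qed

text \<open>
  The difference \<open>D\<close> of two solutions satisfies \<open>d D(\<sigma>) = - \<Sum>\<^sub>i D((i k) \<sigma>)\<close> on \<open>S\<^sub>k\<close> by induction on the level,
  so that \<open>d max |D| \<le> (k - 1) max |D|\<close>.
\<close>

lemma orthogonality_solution_eq_path_series:
  fixes W :: "nat \<Rightarrow> (nat \<Rightarrow> nat) \<Rightarrow> complex"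
  assumes W0: "W 0 id = 1"
    and W: "\<And>k \<sigma>. 1 \<le> k \<Longrightarrow> k \<le> d \<Longrightarrow> \<sigma> permutes {1..k} \<Longrightarrow>
      of_nat d * W k \<sigma> = (if \<sigma> k = k then W (k - 1) \<sigma> else 0)
        - (\<Sum>i\<in>{1..<k}. W k (Transposition.transpose i k \<circ> \<sigma>))"
    and "k \<le> d" "\<sigma> permutes {1..k}"
  shows "W k \<sigma> = of_real (suminf (path_series d k \<sigma>))"
  using assms(4,3)
proof (induction rule: permutes_level_induct)
  case 0
  have "path_series d 0 id = (\<lambda>l. if l = 0 then 1 else 0)"
    by (auto simp: path_series_def num_paths_0)
  then have "suminf (path_series d 0 id) = 1"
    using sums_unique[OF sums_single[of 0 "\<lambda>_. 1 :: real"]] by simp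
  then show ?case by (simp only: W0 of_real_1)
next
  case (step k \<sigma>)
  define D where "D = (\<lambda>\<sigma>. W k \<sigma> - of_real (suminf (path_series d k \<sigma>)))"
  define S where "S = {\<sigma>. \<sigma> permutes {1..k}}"
  have finS: "finite S" unfolding S_def by (rule finite_permutations) simp
  have D: "of_nat d * D \<sigma> = - (\<Sum>i\<in>{1..<k}. D (Transposition.transpose i k \<circ> \<sigma>))" if "\<sigma> \<in> S" for \<sigma>
  proof -
    have s: "\<sigma> permutes {1..k}" using that by (simp add: S_def)
    have "of_nat d * complex_of_real (suminf (path_series d k \<sigma>)) = complex_of_real
       ((if \<sigma> k = k then suminf (path_series d (k - 1) \<sigma>) else 0)
      - (\<Sum>i\<in>{1..<k}. suminf (path_series d k (Transposition.transpose i k \<circ> \<sigma>))))"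
      unfolding suminf_path_series_rec[OF step(1,4) s, symmetric] by simp
    moreover have "W (k - 1) \<sigma> = of_real (suminf (path_series d (k - 1) \<sigma>))" if "\<sigma> k = k"
      using step(3)[OF permutes_pred[OF s that]] step(4) by simp
    ultimately show ?thesis
      using W[OF step(1,4) s] by (simp add: D_def right_diff_distrib sum_subtractf)
  qed
  define m where "m = Max ((\<lambda>\<sigma>. norm (D \<sigma>)) ` S)"
  have mD: "norm (D \<sigma>) \<le> m" if "\<sigma> \<in> S" for \<sigma>
    unfolding m_def using finS that by (intro Max_ge) auto
  have "S \<noteq> {}" using step(2) by (auto simp: S_def)
  then have "m \<in> (\<lambda>\<sigma>. norm (D \<sigma>)) ` S" unfolding m_def using finS by (intro Max_in) auto
  then obtain \<tau> where \<tau>: "\<tau> \<in> S" "m = norm (D \<tau>)" by blast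
  have "real d * m = norm (of_nat d * D \<tau>)" by (simp add: \<tau>(2) norm_mult)
  also have "\<dots> \<le> (\<Sum>i\<in>{1..<k}. norm (D (Transposition.transpose i k \<circ> \<tau>)))"
    unfolding D[OF \<tau>(1)] norm_minus_cancel by (rule norm_sum)
  also have "\<dots> \<le> (\<Sum>i\<in>{1..<k}. m)"
    using \<tau>(1) by (intro sum_mono mD) (simp only: S_def mem_Collect_eq transpose_comp_permutes)
  also have "\<dots> = (real k - 1) * m" using step(1) by (simp add: of_nat_diff)
  finally have "(real d - real k + 1) * m \<le> 0" by (simp add: algebra_simps)
  moreover have "real d - real k + 1 > 0" using step(4) by simp
  ultimately have "m \<le> 0" by (simp add: mult_le_0_iff)
  moreover have "norm (D \<sigma>) \<le> m" using step(2) by (intro mD) (simp add: S_def)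
  ultimately have "norm (D \<sigma>) \<le> 0" by (rule order.trans[rotated])
  then show ?case by (simp add: D_def)
qed

subsection \<open>Catalan numbers\<close>

context
  notes sum.cong [fundef_cong]
begin
fun catalan :: "nat \<Rightarrow> nat" where
  "catalan 0 = 1"
| "catalan (Suc n) = (\<Sum>i\<le>n. catalan i * catalan (n - i))"
end

text \<open>
  The generating function satisfies \<open>c = 1 + X c\<^sup>2\<close>, so \<open>s = 1 - 2 X c\<close> is a square root of
  \<open>1 - 4 X\<close> and hence solves the first-order equation \<open>s' (1 - 4 X) = - 2 s\<close>.
\<close>

lemma catalan_ratio: "(n + 2) * catalan (Suc n) = (4 * n + 2) * catalan n"
proof -
  define c :: "real fps" where "c = Abs_fps (\<lambda>n. real (catalan n))"
  define s where "s = 1 - 2 * fps_X * c"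
  have c: "c = 1 + fps_X * c ^ 2"
  proof (rule fps_ext)
    fix n show "fps_nth c n = fps_nth (1 + fps_X * c ^ 2) n"
    proof (cases n)
      case (Suc m)
      have "fps_nth (c ^ 2) m = real (catalan (Suc m))"
        by (simp add: c_def power2_eq_square fps_mult_nth atLeast0AtMost)
      then show ?thesis by (simp add: Suc c_def del: catalan.simps)
    qed (simp add: c_def)
  qed
  have s2: "s * s = 1 - 4 * fps_X"
    using c unfolding s_def by algebra
  have "s * fps_deriv s + fps_deriv s * s = - 4"
    by (subst fps_deriv_mult[symmetric]) (simp add: s2 fps_deriv_mult)
  then have "2 * (s * fps_deriv s) = 2 * (- 2)" by (simp add: mult.commute)
  then have ds: "s * fps_deriv s = - 2"
    by (metis mult_left_cancel zero_neq_numeral)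
  have "fps_deriv s * (1 - 4 * fps_X) = - 2 * s"
    using s2 ds by algebra
  then have "fps_deriv s - 4 * (fps_X * fps_deriv s) = - 2 * s"
    by (simp add: algebra_simps)
  then have "fps_nth (fps_deriv s - 4 * (fps_X * fps_deriv s)) (Suc n) = fps_nth (- 2 * s) (Suc n)"
    by (rule arg_cong)
  moreover have "fps_nth s (Suc m) = - 2 * real (catalan m)" for m
    by (simp add: s_def c_def mult.assoc fps_numeral_fps_const)
  ultimately have "real ((n + 2) * catalan (Suc n)) = real ((4 * n + 2) * catalan n)"
    by (simp add: fps_numeral_fps_const algebra_simps del: catalan.simps)
  then show ?thesis by (simp only: of_nat_eq_iff)
qed

lemma catalan_pos: "catalan n > 0"
proof (induction n)
  case (Suc n)
  then have "(n + 2) * catalan (Suc n) > 0" unfolding catalan_ratio by simp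
  then show ?case using nat_0_less_mult_iff by blast
qed simp

text \<open>Catalan numbers grow like 4^n / n^(3/2) up to a constant, so after this normalisation
  they stay between positive constants. The square is taken because consecutive values then have a
  ratio rational in \<open>n\<close>.\<close>

definition catalan_density :: "nat \<Rightarrow> real" where
  "catalan_density n = real (catalan n) ^ 2 * (real n + 1) ^ 3 / 16 ^ n"

lemma catalan_Suc_real: "real (catalan (Suc n)) = (4 * real n + 2) / (real n + 2) * real (catalan n)"
proof -
  have "real ((n + 2) * catalan (Suc n)) = real ((4 * n + 2) * catalan n)"
    by (simp only: catalan_ratio)
  then show ?thesis by (simp add: field_simps del: catalan.simps)
qed

lemma catalan_density_Suc:
  "catalan_density (Suc n) =
     catalan_density n * ((2 * real n + 1)\<^sup>2 * (real n + 2) / (4 * (real n + 1) ^ 3))"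
proof -
  have "(2 * t / v * c)\<^sup>2 * v ^ 3 / (16 * w) = c\<^sup>2 * u ^ 3 / w * (t\<^sup>2 * v / (4 * u ^ 3))"
    if "u \<noteq> 0" "v \<noteq> 0" "w \<noteq> 0" for t u v w c :: real
    using that by (simp add: field_simps power2_eq_square power3_eq_cube)
  from this[of "real n + 1" "real n + 2" "16 ^ n" "2 * real n + 1" "real (catalan n)"] show ?thesis
    unfolding catalan_density_def catalan_Suc_real by (simp add: add.commute distrib_left)
qed

lemma decseq_catalan_density: "decseq catalan_density"
proof (rule decseq_SucI)
  fix n
  have "(2 * real n + 1)\<^sup>2 * (real n + 2) \<le> 4 * (real n + 1) ^ 3"
    by (simp add: power2_eq_square power3_eq_cube algebra_simps)
  then have "(2 * real n + 1)\<^sup>2 * (real n + 2) / (4 * (real n + 1) ^ 3) \<le> 1"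
    by (simp add: divide_le_eq_1)
  moreover have "catalan_density n \<ge> 0" by (simp add: catalan_density_def)
  ultimately show "catalan_density (Suc n) \<le> catalan_density n"
    unfolding catalan_density_Suc by (rule mult_left_le)
qed

text \<open>
  The density decreases to \<open>1 / \<pi>\<close>; the constant \<open>1 / 4\<close> becomes provable by induction after
  strengthening it to \<open>(n + 1) / (4 n)\<close>.
\<close>

lemma catalan_density_ge: "catalan_density n \<ge> 1 / 4"
proof (cases n)
  case (Suc m)
  have "catalan_density (Suc m) \<ge> (real m + 2) / (4 * (real m + 1))"
  proof (induction m)
    case 0
    show ?case by (simp add: catalan_density_def)
  next
    case (Suc m)
    define x where "x = real m + 1"
    have x: "x \<ge> 1" by (simp add: x_def)
    have "(x + 2) / (4 * (x + 1)) \<le> (x + 1) / (4 * x) * ((2 * x + 1)\<^sup>2 * (x + 2) / (4 * (x + 1) ^ 3))"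
    proof -
      \<comment> \<open>The quotient of the two sides of the induction step is (2 x + 1)^2 / (4 x (x
        + 1)), which exceeds one since (2 x + 1)^2 = 4 x (x + 1) + 1.\<close>
      have "(x + 2) / (4 * (x + 1)) * 1 \<le> (x + 2) / (4 * (x + 1)) * ((2 * x + 1)\<^sup>2 / (4 * x * (x + 1)))"
      proof (intro mult_left_mono)
        have "4 * x * (x + 1) \<le> (2 * x + 1)\<^sup>2" by (simp add: power2_eq_square algebra_simps)
        moreover have "0 < 4 * x * (x + 1)" using x by simp
        ultimately show "1 \<le> (2 * x + 1)\<^sup>2 / (4 * x * (x + 1))" by simp
      qed (use x in simp)
      also have "\<dots> = (x + 1) / (4 * x) * ((2 * x + 1)\<^sup>2 * (x + 2) / (4 * (x + 1) ^ 3))"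
      proof -
        have "v / (4 * u) * (t / (4 * x * u)) = u / (4 * x) * (t * v / (4 * u ^ 3))"
          if "u \<noteq> 0" for t u v :: real
          using that x by (simp add: field_simps power3_eq_cube)
        from this[of "x + 1"] x show ?thesis by simp
      qed
      finally show ?thesis by simp
    qed
    also have "\<dots> \<le> catalan_density (Suc m) * ((2 * x + 1)\<^sup>2 * (x + 2) / (4 * (x + 1) ^ 3))"
      using Suc x by (intro mult_right_mono) (simp_all add: x_def add.commute)
    also have "\<dots> = catalan_density (Suc (Suc m))"
      by (subst (2) catalan_density_Suc) (simp add: x_def add.commute)
    finally show ?case by (simp add: x_def add.commute)
  qed
  moreover have "1 / 4 \<le> (real m + 2) / (4 * (real m + 1))" by (simp add: field_simps)
  ultimately show ?thesis unfolding Suc by (rule order.trans[rotated])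
qed (simp add: catalan_density_def)

text \<open>This is the cost of merging cycles of lengths n + 1 and m + 1. With D the density,
  monotonicity and D \<ge> 1/4 give D(n + m + 1) \<le> D(n) \<le> 4 D(n) D(m). The 4 and the surplus
  factor 16 in the denominator on the left combine to 4^3, exactly what 4 a b \<le> (a + b)^2
  absorbs; cancelling N^3 and taking the root leaves N^(3/2).\<close>

lemma catalan_add_le:
  "real (catalan (Suc (n + m))) \<le> (real n + real m + 2) * sqrt (real n + real m + 2)
     * real (catalan n * catalan m)"
proof -
  define N where "N = real n + real m + 2"
  have N: "N > 0" by (simp add: N_def)
  define a b where "a = real n + 1" and "b = real m + 1"
  have ab: "a > 0" "b > 0" "N = a + b" by (simp_all add: a_def b_def N_def)
  define x y where "x = real (catalan n) ^ 2" and "y = real (catalan m) ^ 2"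
  have "catalan_density (Suc (n + m)) \<le> catalan_density n * (4 * catalan_density m)"
  proof -
    have "catalan_density (Suc (n + m)) \<le> catalan_density n"
      by (rule decseqD[OF decseq_catalan_density]) simp
    moreover have "catalan_density n * 1 \<le> catalan_density n * (4 * catalan_density m)"
      using catalan_density_ge[of m] by (intro mult_left_mono) (auto simp: catalan_density_def)
    ultimately show ?thesis by simp
  qed
  then have "real (catalan (Suc (n + m))) ^ 2 * N ^ 3 / (16 * 16 ^ n * 16 ^ m)
      \<le> x * a ^ 3 * (4 * (y * b ^ 3)) / (16 ^ n * 16 ^ m)"
    by (simp add: catalan_density_def N_def a_def b_def x_def y_def power_add algebra_simps
      del: catalan.simps)
  then have "real (catalan (Suc (n + m))) ^ 2 * N ^ 3 \<le> x * y * (4 * (a * b)) ^ 3"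
    by (simp add: field_simps power3_eq_cube del: catalan.simps)
  also have "\<dots> \<le> x * y * (N * N) ^ 3"
  proof -
    have "0 \<le> (a - b)\<^sup>2" by simp
    then have "4 * (a * b) \<le> N * N" by (simp add: ab power2_eq_square algebra_simps)
    then show ?thesis
      using ab by (intro mult_left_mono power_mono) (auto simp: x_def y_def)
  qed
  finally have "real (catalan (Suc (n + m))) ^ 2 * N ^ 3 \<le> (x * y * N ^ 3) * N ^ 3"
    by (simp add: power_mult_distrib mult_ac)
  then have "real (catalan (Suc (n + m))) ^ 2 \<le> x * y * N ^ 3"
    using N by (simp del: catalan.simps)
  also have "\<dots> = (N * sqrt N * real (catalan n * catalan m)) ^ 2"
    using N by (simp add: x_def y_def power_mult_distrib power3_eq_cube power2_eq_square)
  finally show ?thesis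
    unfolding N_def by (rule power2_le_imp_le) simp
qed

subsection \<open>Cycles and multiplication by a transposition\<close>

text \<open>A cycle written out from a chosen starting point. With lists, splitting and merging
  cycles become cutting and concatenation.\<close>

definition cycle_list :: "('a \<Rightarrow> 'a) \<Rightarrow> 'a list \<Rightarrow> bool" where
  "cycle_list f xs \<longleftrightarrow> xs \<noteq> [] \<and> distinct xs \<and> map f xs = rotate1 xs"

lemma orbit_cycle_list:
  assumes "cycle_list f xs" "x \<in> set xs"
  shows "orbit f x = set xs"
proof -
  define n where "n = length xs"
  have n: "n > 0" using assms(1) by (simp add: cycle_list_def n_def)
  have step: "f (xs ! i) = xs ! (Suc i mod n)" if "i < n" for i
  proof -
    have "map f xs ! i = rotate1 xs ! i" using assms(1) by (simp add: cycle_list_def)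
    then show ?thesis using that by (simp add: n_def nth_rotate1)
  qed
  have pow: "(f ^^ m) (xs ! i) = xs ! ((i + m) mod n)" if "i < n" for i m
    by (induction m) (simp_all add: that step n mod_Suc_eq)
  obtain i where i: "i < n" "x = xs ! i"
    using assms(2) by (auto simp: in_set_conv_nth n_def)
  have "orbit f x = {xs ! ((i + m) mod n) | m. 0 < m}"
    unfolding orbit_altdef i(2) pow[OF i(1)] ..
  also have "\<dots> = set xs"
  proof (intro set_eqI iffI)
    fix y assume "y \<in> {xs ! ((i + m) mod n) | m. 0 < m}"
    then show "y \<in> set xs" using n by (auto simp: n_def)
  next
    fix y assume "y \<in> set xs"
    then obtain j where j: "j < n" "y = xs ! j" by (auto simp: in_set_conv_nth n_def)
    \<comment> \<open>Adding \<open>n\<close> keeps the subtraction exact and the exponent positive,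
      as \<open>orbit\<close> uses only positive powers.\<close>
    then have "(i + (n + j - i)) mod n = j" "0 < n + j - i" using i(1) by auto
    then show "y \<in> {xs ! ((i + m) mod n) | m. 0 < m}"
      unfolding mem_Collect_eq j(2) by (intro exI[of _ "n + j - i"]) simp
  qed
  finally show ?thesis .
qed

lemma cycle_list_exists:
  assumes "permutation f"
  obtains xs where "cycle_list f (x # xs)"
proof -
  define n where "n = least_power f x"
  have n: "(f ^^ n) x = x" "n > 0"
    using least_power_of_permutation[OF assms] by (simp_all add: n_def)
  define xs where "xs = map (\<lambda>i. (f ^^ i) x) [0..<n]"
  have "distinct xs"
    using cycle_of_permutation[OF assms, of x] by (simp add: xs_def n_def)
  moreover have "map f xs = rotate1 xs"
  proof (rule nth_equalityI)
    fix i assume i: "i < length (map f xs)"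
    then have i': "i < n" by (simp add: xs_def)
    have "rotate1 xs ! i = (f ^^ (Suc i mod n)) x"
      using i' n(2) by (simp add: nth_rotate1 xs_def)
    also have "\<dots> = (f ^^ Suc i) x"
      using i' n by (cases "Suc i = n") auto
    finally show "map f xs ! i = rotate1 xs ! i"
      using i' by (simp add: xs_def)
  qed (simp add: xs_def)
  moreover have "xs = x # tl xs" using n(2) by (simp add: xs_def upt_conv_Cons)
  ultimately have "cycle_list f (x # tl xs)" by (metis cycle_list_def list.distinct(1))
  then show ?thesis by (rule that)
qed

text \<open>Only the last entry of each block leaves it: \<open>f\<close> sends the end of the first
  block to \<open>y\<close> and the end of the second to \<open>x\<close>. Exchanging these two
  values closes each block into a cycle.\<close>

lemma cycle_list_transpose_split:
  assumes "cycle_list f (x # as @ y # bs)"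
  shows "cycle_list (Transposition.transpose x y \<circ> f) (x # as)"
    and "cycle_list (Transposition.transpose x y \<circ> f) (y # bs)"
proof -
  have m: "map f (x # as) @ map f (y # bs) = (as @ [y]) @ bs @ [x]"
    using assms by (simp add: cycle_list_def)
  have l: "length (map f (x # as)) = length (as @ [y])" by simp
  have "map f (x # as) = as @ [y]" "map f (y # bs) = bs @ [x]"
    using m by (simp_all only: append_eq_append_conv[OF disjI1[OF l]])
  moreover have "map (Transposition.transpose x y) as = as" "map (Transposition.transpose x y) bs = bs"
    by (intro map_idI transpose_apply_other; use assms in \<open>auto simp: cycle_list_def\<close>)+
  ultimately have "map (Transposition.transpose x y \<circ> f) (x # as) = rotate1 (x # as)"
    "map (Transposition.transpose x y \<circ> f) (y # bs) = rotate1 (y # bs)"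
    unfolding map_map[symmetric] by simp_all
  then show "cycle_list (Transposition.transpose x y \<circ> f) (x # as)"
    "cycle_list (Transposition.transpose x y \<circ> f) (y # bs)"
    using assms by (simp_all add: cycle_list_def)
qed

lemma cycle_list_transpose_merge:
  assumes "cycle_list f (x # as)" "cycle_list f (y # bs)" "set (x # as) \<inter> set (y # bs) = {}"
  shows "cycle_list (Transposition.transpose x y \<circ> f) (x # as @ y # bs)"
proof -
  have "map f (x # as) = as @ [x]" "map f (y # bs) = bs @ [y]"
    using assms(1,2) by (simp_all add: cycle_list_def)
  moreover have "map (Transposition.transpose x y) as = as" "map (Transposition.transpose x y) bs = bs"
    by (intro map_idI transpose_apply_other; use assms in \<open>auto simp: cycle_list_def\<close>)+
  ultimately have "map (Transposition.transpose x y \<circ> f) (x # as) = as @ [y]"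
    "map (Transposition.transpose x y \<circ> f) (y # bs) = bs @ [x]"
    unfolding map_map[symmetric] by simp_all
  then have "map (Transposition.transpose x y \<circ> f) (x # as @ y # bs) = rotate1 (x # as @ y # bs)"
    by simp
  then show ?thesis
    using assms by (auto simp: cycle_list_def)
qed

lemma orbits_insert:
  assumes "permutation f" "cycle_list f xs" "set xs \<subseteq> S"
  shows "orbit f ` S = insert (set xs) (orbit f ` (S - set xs))"
    and "A \<in> orbit f ` (S - set xs) \<Longrightarrow> A \<inter> set xs = {}"
proof -
  have "orbit f ` set xs = {set xs}"
    using assms(2)
    by (simp add: orbit_cycle_list[OF assms(2)] image_constant_conv cycle_list_def cong: image_cong)
  then have "orbit f ` (set xs \<union> (S - set xs)) = insert (set xs) (orbit f ` (S - set xs))"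
    by (simp only: image_Un) simp
  moreover have "set xs \<union> (S - set xs) = S" using assms(3) by auto
  ultimately show "orbit f ` S = insert (set xs) (orbit f ` (S - set xs))"
    by (simp only:)
  show "A \<inter> set xs = {}" if A: "A \<in> orbit f ` (S - set xs)"
  proof (rule ccontr)
    obtain z where z: "z \<in> S - set xs" "A = orbit f z" using A by auto
    assume "A \<inter> set xs \<noteq> {}"
    then obtain w where w: "w \<in> orbit f z" "w \<in> set xs" using z by auto
    have "z \<in> orbit f w"
      by (rule orbit_swap[OF permutation_self_in_orbit[OF assms(1)] w(1)])
    then show False using orbit_cycle_list[OF assms(2) w(2)] z by auto
  qed
qed

text \<open>Away from the cycle being cut, \<open>f\<close> never takes the value \<open>x\<close>
  or \<open>y\<close>, so the other orbits do not notice the transposition.\<close>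

lemma orbits_transpose_split:
  assumes "permutation f" "cycle_list f (x # as @ y # bs)" "set (x # as @ y # bs) \<subseteq> S"
  defines "R \<equiv> orbit f ` (S - set (x # as @ y # bs))"
  shows "orbit (Transposition.transpose x y \<circ> f) ` S = insert (set (x # as)) (insert (set (y # bs)) R)"
proof -
  let ?g = "Transposition.transpose x y \<circ> f" and ?C = "set (x # as @ y # bs)"
  note c = cycle_list_transpose_split[OF assms(2)]
  have "orbit ?g z = orbit f z" if z: "z \<in> S - ?C" for z
  proof (rule orbit_cong)
    show "z \<in> orbit f z" by (rule permutation_self_in_orbit[OF assms(1)])
    fix w assume "w \<in> orbit f z"
    then have "f w \<in> orbit f z" by (rule orbit.step)
    then have "f w \<noteq> x" "f w \<noteq> y"
      using orbits_insert(2)[OF assms(1-3), of "orbit f z"] z by auto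
    then show "?g w = f w" by (simp add: transpose_apply_other)
  qed
  then have "orbit ?g ` (S - ?C) = R" unfolding R_def by (rule image_cong[OF refl])
  moreover have "orbit ?g ` set (x # as) = {set (x # as)}" "orbit ?g ` set (y # bs) = {set (y # bs)}"
    by (simp_all only: orbit_cycle_list[OF c(1)] orbit_cycle_list[OF c(2)] image_constant_conv
        cong: image_cong) simp_all
  ultimately have "orbit ?g ` (set (x # as) \<union> set (y # bs) \<union> (S - ?C)) =
      insert (set (x # as)) (insert (set (y # bs)) R)"
    by (simp only: image_Un) (simp add: insert_commute)
  moreover have "set (x # as) \<union> set (y # bs) \<union> (S - ?C) = S" using assms(3) by auto
  ultimately show ?thesis by (simp only:)
qed

section \<open>The Catalan weight of a permutation\<close>

text \<open>A fixed point contributes \<open>catalan 0\<close>, which is 1, so a dashed arrow does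
  not change the weight.\<close>

definition catalan_weight :: "nat \<Rightarrow> (nat \<Rightarrow> nat) \<Rightarrow> nat" where
  "catalan_weight k \<sigma> = (\<Prod>A\<in>orbit \<sigma> ` {1..k}. catalan (card A - 1))"

lemma catalan_weight_pos: "catalan_weight k \<sigma> > 0"
  unfolding catalan_weight_def by (rule prod_pos) (simp add: catalan_pos)

lemma num_cycles_le: "num_cycles k \<sigma> \<le> k"
  unfolding num_cycles_def using card_image_le[of "{1..k}" "orbit \<sigma>"] by simp

lemma permutes_permutation_atLeastAtMost:
  fixes k :: nat
  shows "\<sigma> permutes {1..k} \<Longrightarrow> permutation \<sigma>"
  using permutation_permutes by blast

lemma cycle_list_subset:
  assumes "\<sigma> permutes S" "cycle_list \<sigma> xs" "x \<in> set xs" "x \<in> S"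
  shows "set xs \<subseteq> S"
  using permutes_orbit_subset[OF assms(1,4)] orbit_cycle_list[OF assms(2,3)] by simp

text \<open>
  \<open>P\<close> is the weight of the cycles not containing \<open>k\<close>. The third part takes it as a parameter
  because it must be the same for all splittings of the cycle of \<open>k\<close>.
\<close>

lemma cycle_split:
  assumes \<sigma>: "\<sigma> permutes {1..k}" and c: "cycle_list \<sigma> (k # as @ i # bs)"
    and k: "1 \<le> k"
  shows "num_cycles k (Transposition.transpose i k \<circ> \<sigma>) = Suc (num_cycles k \<sigma>)"
    and "\<exists>P. catalan_weight k \<sigma> = catalan (length as + length bs + 1) * P"
    and "catalan_weight k \<sigma> = catalan (Suc (length as + length bs)) * P \<Longrightarrow>
      catalan_weight k (Transposition.transpose i k \<circ> \<sigma>)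
        = catalan (length as) * catalan (length bs) * P"
proof -
  note perm = permutes_permutation_atLeastAtMost[OF \<sigma>]
  define C where "C = set (k # as @ i # bs)"
  have C: "C \<subseteq> {1..k}"
    unfolding C_def by (rule cycle_list_subset[OF \<sigma> c, of k]) (use k in auto)
  define R where "R = orbit \<sigma> ` ({1..k} - C)"
  have fin: "finite R" by (simp add: R_def)
  have o1: "orbit \<sigma> ` {1..k} = insert C R"
    unfolding R_def C_def by (rule orbits_insert(1)[OF perm c C[unfolded C_def]])
  have o2: "orbit (Transposition.transpose i k \<circ> \<sigma>) ` {1..k} = insert (set (k # as)) (insert (set (i # bs)) R)"
    unfolding R_def C_def
    using orbits_transpose_split[OF perm c C[unfolded C_def]] by (simp add: transpose_commute)
  have disj: "A \<inter> C = {}" if "A \<in> R" for A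
    using that unfolding R_def C_def by (rule orbits_insert(2)[OF perm c C[unfolded C_def]])
  have dist: "distinct (k # as @ i # bs)" using c by (simp add: cycle_list_def)
  have nin: "C \<notin> R" "set (k # as) \<notin> R" "set (i # bs) \<notin> R" "set (k # as) \<noteq> set (i # bs)"
    using disj[of C] disj[of "set (k # as)"] disj[of "set (i # bs)"] dist by (auto simp: C_def)
  have card: "card C = Suc (Suc (length as + length bs))" "card (set (k # as)) = Suc (length as)"
    "card (set (i # bs)) = Suc (length bs)"
    using distinct_card[OF dist] distinct_card[of "k # as"] distinct_card[of "i # bs"] dist
    by (simp_all add: C_def)
  show "num_cycles k (Transposition.transpose i k \<circ> \<sigma>) = Suc (num_cycles k \<sigma>)"
    unfolding num_cycles_def o1 o2 using fin nin by (simp del: list.set)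
  define Q where "Q = (\<Prod>A\<in>R. catalan (card A - 1))"
  have w1: "catalan_weight k \<sigma> = catalan (Suc (length as + length bs)) * Q"
    unfolding catalan_weight_def o1 using fin nin card
    by (simp add: Q_def del: list.set catalan.simps)
  then show "\<exists>P. catalan_weight k \<sigma> = catalan (length as + length bs + 1) * P"
    by (auto simp del: catalan.simps)
  assume "catalan_weight k \<sigma> = catalan (Suc (length as + length bs)) * P"
  then have "P = Q" using w1 catalan_pos[of "Suc (length as + length bs)"]
    by (simp del: catalan.simps)
  have "catalan_weight k (Transposition.transpose i k \<circ> \<sigma>) = catalan (length as) * catalan (length bs) * Q"
    unfolding catalan_weight_def o2 using fin nin card
    by (simp add: Q_def del: list.set catalan.simps)
  then show "catalan_weight k (Transposition.transpose i k \<circ> \<sigma>)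
    = catalan (length as) * catalan (length bs) * P" using \<open>P = Q\<close> by simp
qed

lemma perm_norm_transpose_split:
  assumes "\<sigma> permutes {1..k}" "i \<in> {1..<k}" "i \<in> orbit \<sigma> k"
  shows "perm_norm k \<sigma> = Suc (perm_norm k (Transposition.transpose i k \<circ> \<sigma>))"
proof -
  obtain cs where cs: "cycle_list \<sigma> (k # cs)"
    using cycle_list_exists[OF permutes_permutation_atLeastAtMost[OF assms(1)]] by blast
  then have "i \<in> set cs" using orbit_cycle_list[OF cs, of k] assms(2,3) by auto
  then obtain as bs where "cs = as @ i # bs" by (meson split_list)
  then have "num_cycles k (Transposition.transpose i k \<circ> \<sigma>) = Suc (num_cycles k \<sigma>)"
    using cycle_split(1)[OF assms(1), of as i bs] cs assms(2) by simp
  then show ?thesis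
    using num_cycles_le[of k "Transposition.transpose i k \<circ> \<sigma>"] by (simp add: perm_norm_def)
qed

text \<open>A second multiplication by the transposition undoes the merge, so
  \<open>cycle_split\<close> applies to \<open>\<sigma>'\<close> with \<sigma> as the result. The
  weights differ only in that one Catalan number of index n + m + 1 replaces the product of those of
  indices n and m; \<open>catalan_add_le\<close> compares them, and the merged cycle has n + m + 2
  \<le> k elements.\<close>

lemma transpose_merge:
  assumes \<sigma>: "\<sigma> permutes {1..k}" and i: "i \<in> {1..<k}" "i \<notin> orbit \<sigma> k"
  defines "\<sigma>' \<equiv> Transposition.transpose i k \<circ> \<sigma>"
  shows "perm_norm k \<sigma>' = Suc (perm_norm k \<sigma>)"
    and "real (catalan_weight k \<sigma>') \<le> real k * sqrt (real k) * real (catalan_weight k \<sigma>)"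
proof -
  note perm = permutes_permutation_atLeastAtMost[OF \<sigma>]
  obtain as where as: "cycle_list \<sigma> (k # as)" using cycle_list_exists[OF perm] by blast
  obtain bs where bs: "cycle_list \<sigma> (i # bs)" using cycle_list_exists[OF perm] by blast
  have "set (k # as) \<inter> set (i # bs) = {}"
  proof (rule ccontr)
    assume "set (k # as) \<inter> set (i # bs) \<noteq> {}"
    then obtain x where "x \<in> set (k # as)" "x \<in> set (i # bs)" by blast
    then have "set (k # as) = set (i # bs)"
      using orbit_cycle_list[OF as] orbit_cycle_list[OF bs] by blast
    then show False using i(2) orbit_cycle_list[OF as, of k] by auto
  qed
  then have c: "cycle_list \<sigma>' (k # as @ i # bs)"
    using cycle_list_transpose_merge[OF as bs] by (simp add: \<sigma>'_def transpose_commute)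
  have \<sigma>': "\<sigma>' permutes {1..k}" unfolding \<sigma>'_def by (rule transpose_comp_permutes[OF \<sigma> i(1)])
  have undo: "Transposition.transpose i k \<circ> \<sigma>' = \<sigma>"
    by (simp add: \<sigma>'_def flip: comp_assoc)
  have k: "1 \<le> k" using i by auto
  note split = cycle_split[OF \<sigma>' c k, unfolded undo]
  show "perm_norm k \<sigma>' = Suc (perm_norm k \<sigma>)"
    using split(1) num_cycles_le[of k \<sigma>] by (simp add: perm_norm_def)
  obtain P where P: "catalan_weight k \<sigma>' = catalan (Suc (length as + length bs)) * P"
    using split(2) by (auto simp del: catalan.simps)
  have "set (k # as @ i # bs) \<subseteq> {1..k}"
    by (rule cycle_list_subset[OF \<sigma>' c, of k]) (use k in auto)
  then have "card (set (k # as @ i # bs)) \<le> k"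
    using card_mono[of "{1..k}"] by fastforce
  moreover have "distinct (k # as @ i # bs)" using c by (simp add: cycle_list_def)
  ultimately have len: "length as + length bs + 2 \<le> k" using distinct_card by fastforce
  define N where "N = real (length as) + real (length bs) + 2"
  have N: "0 \<le> N" "N \<le> real k" using len by (auto simp: N_def)
  have "real (catalan_weight k \<sigma>') \<le> N * sqrt N * real (catalan (length as) * catalan (length bs)) * real P"
    unfolding P N_def of_nat_mult[of "catalan _" P]
    by (intro mult_right_mono catalan_add_le) simp
  also have "\<dots> = N * sqrt N * real (catalan_weight k \<sigma>)"
    by (simp add: split(3)[OF P])
  also have "\<dots> \<le> real k * sqrt (real k) * real (catalan_weight k \<sigma>)"
    using N by (intro mult_right_mono mult_mono) auto
  finally show "real (catalan_weight k \<sigma>') \<le> real k * sqrt (real k) * real (catalan_weight k \<sigma>)" .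
qed

lemma fixed_point_level:
  assumes "\<sigma> permutes {1..k}" "\<sigma> k = k" "1 \<le> k"
  shows "perm_norm (k - 1) \<sigma> = perm_norm k \<sigma>" "catalan_weight (k - 1) \<sigma> = catalan_weight k \<sigma>"
proof -
  note perm = permutes_permutation_atLeastAtMost[OF assms(1)]
  have c: "cycle_list \<sigma> [k]" using assms(2) by (simp add: cycle_list_def)
  have "{1..k} - set [k] = {1..k - 1}" by auto
  then have o: "orbit \<sigma> ` {1..k} = insert {k} (orbit \<sigma> ` {1..k - 1})"
    "{k} \<notin> orbit \<sigma> ` {1..k - 1}"
    using orbits_insert(1)[OF perm c, of "{1..k}"] orbits_insert(2)[OF perm c, of "{1..k}" "{k}"]
      assms(3) by auto
  then show "catalan_weight (k - 1) \<sigma> = catalan_weight k \<sigma>"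
    by (simp add: catalan_weight_def)
  have "num_cycles k \<sigma> = Suc (num_cycles (k - 1) \<sigma>)"
    using o by (simp add: num_cycles_def)
  then show "perm_norm (k - 1) \<sigma> = perm_norm k \<sigma>"
    using assms(3) by (simp add: perm_norm_def)
qed

subsection \<open>Bounds on the number of paths\<close>

text \<open>If the cycle of \<open>k\<close> has m + 2 elements, cutting it at its other elements
  gives cycles of lengths j + 1 and m - j + 1, once for each j \<le> m. All other cycles are
  unaffected, so the sum is the Catalan recurrence for index m + 1.\<close>

lemma catalan_weight_rec:
  assumes \<sigma>: "\<sigma> permutes {1..k}" and k: "1 \<le> k"
  shows "catalan_weight k \<sigma> = (if \<sigma> k = k then catalan_weight (k - 1) \<sigma> else 0)
    + (\<Sum>i\<in>{i\<in>{1..<k}. i \<in> orbit \<sigma> k}. catalan_weight k (Transposition.transpose i k \<circ> \<sigma>))"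
proof -
  obtain cs where cs: "cycle_list \<sigma> (k # cs)"
    using cycle_list_exists[OF permutes_permutation_atLeastAtMost[OF \<sigma>]] by blast
  have "set (k # cs) \<subseteq> {1..k}"
    by (rule cycle_list_subset[OF \<sigma> cs, of k]) (use k in auto)
  moreover have "k \<notin> set cs" "distinct cs" using cs by (auto simp: cycle_list_def)
  moreover have "orbit \<sigma> k = set (k # cs)" using orbit_cycle_list[OF cs, of k] by simp
  ultimately have I: "{i\<in>{1..<k}. i \<in> orbit \<sigma> k} = set cs"
    by (force simp: order.strict_iff_order)
  show ?thesis
  proof (cases cs)
    case Nil
    then have "\<sigma> k = k" using cs by (simp add: cycle_list_def)
    then show ?thesis unfolding I using fixed_point_level(2)[OF \<sigma> _ k] Nil by simp
  next
    case (Cons x xs)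
    define m where "m = length xs"
    have len: "length cs = Suc m" by (simp add: Cons m_def)
    have split_at: "cycle_list \<sigma> (k # take j cs @ cs ! j # drop (Suc j) cs)" if "j < Suc m" for j
      using cs id_take_nth_drop[of j cs] that len by simp
    have "\<sigma> k = x" using cs by (simp add: cycle_list_def Cons)
    then have "\<sigma> k \<noteq> k" using \<open>k \<notin> set cs\<close> Cons by auto
    obtain P where P: "catalan_weight k \<sigma> = catalan (Suc m) * P"
      using cycle_split(2)[OF \<sigma> split_at[of 0] k] len by (auto simp del: catalan.simps)
    have w: "catalan_weight k (Transposition.transpose (cs ! j) k \<circ> \<sigma>) = catalan j * catalan (m - j) * P"
      if "j < Suc m" for j
    proof -
      have l: "length (take j cs) = j" "length (drop (Suc j) cs) = m - j" "j + (m - j) = m"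
        using that len by auto
      show ?thesis
        using cycle_split(3)[OF \<sigma> split_at[OF that] k] P unfolding l by blast
    qed
    have "bij_betw (\<lambda>j. cs ! j) {..<Suc m} (set cs)"
      by (rule bij_betw_nth) (use \<open>distinct cs\<close> len in auto)
    then have "(\<Sum>i\<in>set cs. catalan_weight k (Transposition.transpose i k \<circ> \<sigma>))
      = (\<Sum>j<Suc m. catalan_weight k (Transposition.transpose (cs ! j) k \<circ> \<sigma>))"
      by (rule sum.reindex_bij_betw[symmetric])
    also have "\<dots> = (\<Sum>j<Suc m. catalan j * catalan (m - j) * P)"
      by (rule sum.cong) (use w in auto)
    also have "\<dots> = catalan_weight k \<sigma>"
      unfolding P by (simp add: sum_distrib_right lessThan_Suc_atMost)
    finally show ?thesis unfolding I using \<open>\<sigma> k \<noteq> k\<close> by simp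
  qed
qed

lemma num_paths_nonzero:
  assumes "\<sigma> permutes {1..k}" "num_paths k \<sigma> l \<noteq> 0"
  shows "perm_norm k \<sigma> \<le> l \<and> even (l + perm_norm k \<sigma>)"
  using assms
proof (induction arbitrary: l rule: permutes_level_induct)
  case 0
  then have "l = 0" unfolding num_paths_0 by presburger
  then show ?case by (simp add: perm_norm_def)
next
  case (step k \<sigma>)
  from step(2,4) show ?case
  proof (induction l arbitrary: \<sigma> rule: less_induct)
    case (less l \<sigma>)
    have "(\<sigma> k = k \<and> num_paths (k - 1) \<sigma> l \<noteq> 0) \<or>
      (l \<noteq> 0 \<and> (\<exists>i\<in>{1..<k}. num_paths k (Transposition.transpose i k \<circ> \<sigma>) (l - 1) \<noteq> 0))"
      using less.prems(2) sum.not_neutral_contains_not_neutral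
      unfolding num_paths_rec[OF less.prems(1) step(1)] by (fastforce split: if_splits)
    then show ?case
    proof (elim disjE conjE bexE)
      assume "\<sigma> k = k" "num_paths (k - 1) \<sigma> l \<noteq> 0"
      then show ?thesis
        using step(3)[OF permutes_pred[OF less.prems(1)]]
          fixed_point_level(1)[OF less.prems(1) _ step(1)] by simp
    next
      fix i assume l: "l \<noteq> 0" and i: "i \<in> {1..<k}"
        and ne: "num_paths k (Transposition.transpose i k \<circ> \<sigma>) (l - 1) \<noteq> 0"
      have IH: "perm_norm k (Transposition.transpose i k \<circ> \<sigma>) \<le> l - 1 \<and>
        even (l - 1 + perm_norm k (Transposition.transpose i k \<circ> \<sigma>))"
        by (rule less.IH[OF _ transpose_comp_permutes[OF less.prems(1) i] ne]) (use l in simp)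
      have "perm_norm k \<sigma> = Suc (perm_norm k (Transposition.transpose i k \<circ> \<sigma>)) \<or>
        perm_norm k (Transposition.transpose i k \<circ> \<sigma>) = Suc (perm_norm k \<sigma>)"
        using perm_norm_transpose_split[OF less.prems(1) i] transpose_merge(1)[OF less.prems(1) i]
        by blast
      then show ?thesis using IH l by presburger
    qed
  qed
qed

text \<open>A path of length |\<sigma>| cannot start by merging cycles: it would have |\<sigma>| - 1
  solid steps left to remove a norm of |\<sigma>| + 1. Only dashed and splitting arrows remain, and
  for these the path recursion is \<open>catalan_weight_rec\<close>.\<close>

lemma num_paths_perm_norm:
  assumes "\<sigma> permutes {1..k}"
  shows "num_paths k \<sigma> (perm_norm k \<sigma>) = catalan_weight k \<sigma>"
  using assms
proof (induction rule: permutes_level_induct)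
  case 0
  show ?case unfolding num_paths_0 by (simp add: perm_norm_def catalan_weight_def)
next
  case (step k \<sigma>)
  from step(2) show ?case
  proof (induction "perm_norm k \<sigma>" arbitrary: \<sigma> rule: less_induct)
    case (less \<sigma>)
    let ?n = "perm_norm k \<sigma>" and ?s = "\<lambda>i. Transposition.transpose i k \<circ> \<sigma>"
    let ?I = "{i\<in>{1..<k}. i \<in> orbit \<sigma> k}"
    have up: "num_paths k (?s i) (?n - 1) = 0" if "i \<in> {1..<k} - ?I" for i
    proof -
      have i: "i \<in> {1..<k}" "i \<notin> orbit \<sigma> k" using that by auto
      then show ?thesis
        using num_paths_nonzero[OF transpose_comp_permutes[OF less.prems i(1)], of "?n - 1"]
          transpose_merge(1)[OF less.prems i] by fastforce
    qed
    have down: "?n \<noteq> 0 \<and> num_paths k (?s i) (?n - 1) = catalan_weight k (?s i)" if "i \<in> ?I" for i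
    proof -
      have i: "i \<in> {1..<k}" "i \<in> orbit \<sigma> k" using that by auto
      then have "?n = Suc (perm_norm k (?s i))" by (rule perm_norm_transpose_split[OF less.prems])
      then show ?thesis
        using less.hyps[OF _ transpose_comp_permutes[OF less.prems i(1)]] by simp
    qed
    have "(if ?n = 0 then 0 else \<Sum>i\<in>{1..<k}. num_paths k (?s i) (?n - 1))
      = (\<Sum>i\<in>?I. catalan_weight k (?s i))"
    proof (cases "?n = 0")
      case True
      then have "?I = {}" using down by blast
      then show ?thesis using True by (simp only: if_True sum.empty refl)
    next
      case False
      have "(\<Sum>i\<in>{1..<k}. num_paths k (?s i) (?n - 1)) = (\<Sum>i\<in>?I. num_paths k (?s i) (?n - 1))"
        by (rule sum.mono_neutral_right) (use up in auto)
      also have "\<dots> = (\<Sum>i\<in>?I. catalan_weight k (?s i))"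
        by (rule sum.cong) (use down in auto)
      finally show ?thesis using False by simp
    qed
    moreover have "(if \<sigma> k = k then num_paths (k - 1) \<sigma> ?n else 0)
      = (if \<sigma> k = k then catalan_weight (k - 1) \<sigma> else 0)"
      using step(3)[OF permutes_pred[OF less.prems]] fixed_point_level(1)[OF less.prems _ step(1)]
      by simp
    ultimately show ?case
      unfolding num_paths_rec[OF less.prems step(1)] catalan_weight_rec[OF less.prems step(1)]
      by (simp only:)
  qed
qed

text \<open>A path may start with a step \<open>\<sigma> \<rightarrow> (i k) \<sigma>\<close> which is undone at once.\<close>

lemma num_paths_add_two_ge:
  assumes "\<sigma> permutes {1..k}" "1 \<le> k"
  shows "(k - 1) * num_paths k \<sigma> l \<le> num_paths k \<sigma> (Suc (Suc l))"
proof -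
  have "num_paths k \<sigma> l \<le> num_paths k (Transposition.transpose i k \<circ> \<sigma>) (Suc l)" if "i \<in> {1..<k}" for i
  proof -
    have "num_paths k (Transposition.transpose i k \<circ> (Transposition.transpose i k \<circ> \<sigma>)) l
      \<le> (\<Sum>j\<in>{1..<k}. num_paths k (Transposition.transpose j k \<circ> (Transposition.transpose i k \<circ> \<sigma>)) l)"
      by (rule member_le_sum) (use that in auto)
    also have "\<dots> \<le> num_paths k (Transposition.transpose i k \<circ> \<sigma>) (Suc l)"
      unfolding num_paths_rec[OF transpose_comp_permutes[OF assms(1) that] assms(2), of "Suc l"]
      by simp
    finally show ?thesis by (simp flip: comp_assoc)
  qed
  then have "(\<Sum>i\<in>{1..<k}. num_paths k \<sigma> l)
    \<le> (\<Sum>i\<in>{1..<k}. num_paths k (Transposition.transpose i k \<circ> \<sigma>) (Suc l))"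
    by (rule sum_mono)
  also have "\<dots> \<le> num_paths k \<sigma> (Suc (Suc l))"
    unfolding num_paths_rec[OF assms, of "Suc (Suc l)"] by simp
  finally show ?thesis by simp
qed

lemma num_paths_ge:
  assumes "\<sigma> permutes {1..k}" "1 \<le> k"
  shows "(k - 1) ^ g * catalan_weight k \<sigma> \<le> num_paths k \<sigma> (perm_norm k \<sigma> + 2 * g)"
proof (induction g)
  case 0
  show ?case by (simp add: num_paths_perm_norm[OF assms(1)])
next
  case (Suc g)
  have "(k - 1) ^ Suc g * catalan_weight k \<sigma> \<le> (k - 1) * num_paths k \<sigma> (perm_norm k \<sigma> + 2 * g)"
    using mult_left_mono[OF Suc, of "k - 1"] by (simp add: mult.assoc)
  also have "\<dots> \<le> num_paths k \<sigma> (perm_norm k \<sigma> + 2 * Suc g)"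
    using num_paths_add_two_ge[OF assms] by simp
  finally show ?case .
qed

text \<open>
  A path with \<open>g + 1\<close> steps increasing the norm is cut at the first of them. At most \<open>k + |\<sigma>|\<close> steps
  precede it, there are at most \<open>K\<close> ways to choose it, and by the estimate for Catalan numbers it
  raises the number of shortest paths by a factor of at most \<open>K\<^sup>3\<^sup>/\<^sup>2\<close>.
\<close>

lemma num_paths_le:
  assumes "\<sigma> permutes {1..k}" "k \<le> K"
  shows "real (num_paths k \<sigma> (perm_norm k \<sigma> + 2 * g))
    \<le> (2 * real K * (real K * (real K * sqrt (real K)))) ^ g * real (catalan_weight k \<sigma>)"
  using assms
proof (induction g arbitrary: k \<sigma>)
  case 0
  then show ?case by (simp add: num_paths_perm_norm)
next
  case (Suc g)
  define c where "c = real K * sqrt (real K)"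
  define M where "M = (2 * real K * (real K * c)) ^ g"
  have c: "c \<ge> 0" and M: "M \<ge> 0" by (simp_all add: c_def M_def)
  define X where "X = real K * (c * M)"
  have X: "X \<ge> 0" using c M by (simp add: X_def)
  \<comment> \<open>\<open>K\<close> stays fixed while the level drops along the path, so the factor
    \<open>M\<close> is the same at every vertex where the path may be cut.\<close>
  have IHg: "real (num_paths k \<sigma> (perm_norm k \<sigma> + 2 * g)) \<le> M * real (catalan_weight k \<sigma>)"
    if "\<sigma> permutes {1..k}" "k \<le> K" for k \<sigma>
    using Suc.IH[OF that] by (simp add: M_def c_def)
  have main: "real (num_paths k \<sigma> (perm_norm k \<sigma> + 2 * Suc g))
    \<le> (real k + real (perm_norm k \<sigma>)) * X * real (catalan_weight k \<sigma>)"
    if "\<sigma> permutes {1..k}" "k \<le> K" for k \<sigma>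
    using that
  proof (induction rule: permutes_level_induct)
    case 0
    show ?case unfolding num_paths_0 using X by (intro order.trans[OF _ mult_nonneg_nonneg]) auto
  next
    case (step k \<sigma>)
    from step(2) show ?case
    proof (induction "perm_norm k \<sigma>" arbitrary: \<sigma> rule: less_induct)
      case (less \<sigma>)
      let ?s = "\<lambda>i. Transposition.transpose i k \<circ> \<sigma>"
      define n where "n = perm_norm k \<sigma>"
      define I where "I = {i\<in>{1..<k}. i \<in> orbit \<sigma> k}"
      \<comment> \<open>A dashed arrow lowers \<open>k\<close> and a splitting arrow lowers the
        norm, so either way \<open>k + n\<close> drops by one and the same factor \<open>H\<close>
        applies afterwards. The merging arrows together account for one further
        \<open>X\<close>.\<close>
      define H where "H = (real k + real n - 1) * X"
      have H: "H \<ge> 0" using X step(1) by (simp add: H_def)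
      have fixed: "real (if \<sigma> k = k then num_paths (k - 1) \<sigma> (n + 2 * Suc g) else 0)
        \<le> H * real (if \<sigma> k = k then catalan_weight (k - 1) \<sigma> else 0)"
      proof (cases "\<sigma> k = k")
        case True
        have Hk: "H = (real (k - 1) + real n) * X" using step(1) by (simp add: H_def)
        then show ?thesis
          using step(3)[OF permutes_pred[OF less.prems True]] step(4) True
            fixed_point_level(1)[OF less.prems True step(1)]
          unfolding Hk n_def by simp
      qed simp
      have down: "real (num_paths k (?s i) (n + 2 * Suc g - 1)) \<le> H * real (catalan_weight k (?s i))"
        if "i \<in> I" for i
      proof -
        have i: "i \<in> {1..<k}" "i \<in> orbit \<sigma> k" using that by (auto simp: I_def)
        then have n: "n = Suc (perm_norm k (?s i))"
          unfolding n_def by (rule perm_norm_transpose_split[OF less.prems])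
        show ?thesis
          using less.hyps[OF _ transpose_comp_permutes[OF less.prems i(1)]] n
          by (simp add: H_def n_def)
      qed
      have up: "real (num_paths k (?s i) (n + 2 * Suc g - 1)) \<le> c * M * real (catalan_weight k \<sigma>)"
        if "i \<in> {1..<k} - I" for i
      proof -
        have i: "i \<in> {1..<k}" "i \<notin> orbit \<sigma> k" using that by (auto simp: I_def)
        have n: "perm_norm k (?s i) = Suc n"
          unfolding n_def by (rule transpose_merge(1)[OF less.prems i])
        have "real (num_paths k (?s i) (n + 2 * Suc g - 1)) \<le> M * real (catalan_weight k (?s i))"
          using IHg[OF transpose_comp_permutes[OF less.prems i(1)] step(4)] n by simp
        also have "\<dots> \<le> M * (real k * sqrt (real k) * real (catalan_weight k \<sigma>))"
          by (intro mult_left_mono transpose_merge(2)[OF less.prems i] M)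
        also have "\<dots> \<le> M * (c * real (catalan_weight k \<sigma>))"
          unfolding c_def using step(4)
          by (intro mult_left_mono mult_right_mono mult_mono M) auto
        finally show ?thesis by (simp add: mult_ac)
      qed
      have sub: "I \<subseteq> {1..<k}" by (auto simp: I_def)
      have "real (num_paths k \<sigma> (n + 2 * Suc g)) =
        real (if \<sigma> k = k then num_paths (k - 1) \<sigma> (n + 2 * Suc g) else 0) +
        (\<Sum>i\<in>{1..<k}. real (num_paths k (?s i) (n + 2 * Suc g - 1)))"
        by (subst num_paths_rec[OF less.prems step(1)]) simp
      also have "(\<Sum>i\<in>{1..<k}. real (num_paths k (?s i) (n + 2 * Suc g - 1))) =
        (\<Sum>i\<in>{1..<k} - I. real (num_paths k (?s i) (n + 2 * Suc g - 1)))
        + (\<Sum>i\<in>I. real (num_paths k (?s i) (n + 2 * Suc g - 1)))"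
        by (rule sum.subset_diff[OF sub]) simp
      also have "(\<Sum>i\<in>{1..<k} - I. real (num_paths k (?s i) (n + 2 * Suc g - 1)))
        \<le> (\<Sum>i\<in>{1..<k} - I. c * M * real (catalan_weight k \<sigma>))"
        by (rule sum_mono) (rule up)
      also have "\<dots> \<le> X * real (catalan_weight k \<sigma>)"
      proof -
        have "card ({1..<k} - I) \<le> card {1..<k}" by (rule card_mono) auto
        then have "real (card ({1..<k} - I)) \<le> real K" using step(4) by simp
        then have "real (card ({1..<k} - I)) * (c * M * real (catalan_weight k \<sigma>))
          \<le> real K * (c * M * real (catalan_weight k \<sigma>))"
          using c M by (intro mult_right_mono) auto
        then show ?thesis by (simp add: X_def mult.assoc)
      qed
      also have "(\<Sum>i\<in>I. real (num_paths k (?s i) (n + 2 * Suc g - 1)))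
        \<le> (\<Sum>i\<in>I. H * real (catalan_weight k (?s i)))"
        by (rule sum_mono) (rule down)
      also note fixed
      also have "H * real (if \<sigma> k = k then catalan_weight (k - 1) \<sigma> else 0) +
        (X * real (catalan_weight k \<sigma>) + (\<Sum>i\<in>I. H * real (catalan_weight k (?s i))))
        = H * real (catalan_weight k \<sigma>) + X * real (catalan_weight k \<sigma>)"
        unfolding catalan_weight_rec[OF less.prems step(1), folded I_def]
        by (simp add: distrib_left sum_distrib_left)
      also have "\<dots> = (real k + real n) * X * real (catalan_weight k \<sigma>)"
        by (simp add: H_def algebra_simps)
      finally show ?case by (simp add: n_def)
    qed
  qed
  have "real k + real (perm_norm k \<sigma>) \<le> 2 * real K"
    using Suc.prems(2) by (simp add: perm_norm_def)
  then have "(real k + real (perm_norm k \<sigma>)) * X * real (catalan_weight k \<sigma>)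
    \<le> 2 * real K * X * real (catalan_weight k \<sigma>)"
    using X by (intro mult_right_mono) auto
  also have "2 * real K * X = (2 * real K * (real K * c)) ^ Suc g"
    by (simp add: X_def M_def)
  finally show ?case
    using main[OF Suc.prems] by (simp add: c_def)
qed

section \<open>Comparison with geometric series\<close>

text \<open>Dropping the lengths without paths leaves l = |\<sigma>| + 2 g, for which (-1)^l =
  (-1)^|\<sigma>|. After normalisation all terms are nonnegative and can be compared one by one with
  a geometric series.\<close>

lemma Wg_U_sums:
  fixes \<mu> :: "(complex^'d^'d::finite) measure"
  assumes "normalized_haar_unitary \<mu>" "bij_betw e {1..d} (UNIV :: 'd set)"
    and "1 \<le> k" "k \<le> d" "\<sigma> permutes {1..k}"
  defines "n \<equiv> perm_norm k \<sigma>"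
  shows "Wg_U \<mu> e k \<sigma> \<in> \<real>"
    and "(\<lambda>g. real (num_paths k \<sigma> (n + 2 * g)) / real d ^ (2 * g)) sums
      ((-1) ^ n * real d ^ (k + n) * Re (Wg_U \<mu> e k \<sigma>))"
proof -
  have W: "Wg_U \<mu> e k \<sigma> = of_real (suminf (path_series d k \<sigma>))"
    by (rule orthogonality_solution_eq_path_series[where W = "Wg_U \<mu> e",
          OF Wg_U_0[OF assms(1)] Wg_U_orthogonality[OF assms(1,2)] assms(4,5)])
  then show "Wg_U \<mu> e k \<sigma> \<in> \<real>" by simp
  have d: "real d > 0" using assms(3,4) by simp
  have "path_series d k \<sigma> sums Re (Wg_U \<mu> e k \<sigma>)"
    unfolding W Re_complex_of_real
    by (intro summable_sums summable_path_series assms)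
  moreover have "path_series d k \<sigma> l = 0" if "l \<notin> range (\<lambda>g. n + 2 * g)" for l
  proof -
    have "\<not> (n \<le> l \<and> even (l + n))"
    proof
      assume l: "n \<le> l \<and> even (l + n)"
      then have "l = n + 2 * ((l - n) div 2)" by presburger
      then show False using that by blast
    qed
    then have "num_paths k \<sigma> l = 0"
      using num_paths_nonzero[OF assms(5)] unfolding n_def by blast
    then show ?thesis by (simp add: path_series_def)
  qed
  ultimately have "(\<lambda>g. path_series d k \<sigma> (n + 2 * g)) sums Re (Wg_U \<mu> e k \<sigma>)"
    by (subst sums_mono_reindex) (auto simp: strict_mono_def)
  then have "(\<lambda>g. (-1) ^ n * real d ^ (k + n) * path_series d k \<sigma> (n + 2 * g)) sums
    ((-1) ^ n * real d ^ (k + n) * Re (Wg_U \<mu> e k \<sigma>))"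
    by (rule sums_mult)
  moreover have "(-1) ^ n * real d ^ (k + n) * path_series d k \<sigma> (n + 2 * g)
    = real (num_paths k \<sigma> (n + 2 * g)) / real d ^ (2 * g)" for g
  proof -
    have "real d ^ (k + (n + 2 * g)) = real d ^ (k + n) * real d ^ (2 * g)"
      by (simp only: power_add mult.assoc)
    moreover have "(-1 :: real) ^ n * (-1) ^ (n + 2 * g) = 1"
      by (simp add: power_add flip: power_mult_distrib)
    ultimately show ?thesis using d
      by (simp add: path_series_def field_simps)
  qed
  ultimately show "(\<lambda>g. real (num_paths k \<sigma> (n + 2 * g)) / real d ^ (2 * g)) sums
      ((-1) ^ n * real d ^ (k + n) * Re (Wg_U \<mu> e k \<sigma>))"
    by simp
qed

theorem theorem3p2:
  fixes \<mu> :: "(complex^'d^'d) measure"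
    and e :: "nat \<Rightarrow> 'd::finite"
    and d k :: nat
    and \<sigma> :: "nat \<Rightarrow> nat"
  assumes "d = CARD('d)"
    and "normalized_haar_unitary \<mu>"
    and "bij_betw e {1..d} UNIV"
    and "1 \<le> k" and "k \<le> d"
    and "\<sigma> permutes {1..k}"
  shows "Wg_U \<mu> e k \<sigma> \<in> \<real> \<and>
    1 / (1 - (real k - 1) / (real d)^2)
      \<le> (-1) ^ perm_norm k \<sigma> * real d ^ (k + perm_norm k \<sigma>) * Re (Wg_U \<mu> e k \<sigma>)
          / real (card (wg_paths k \<sigma> (perm_norm k \<sigma>))) \<and>
    (real d > sqrt 6 * real k powr (7/4) \<longrightarrow>
      (-1) ^ perm_norm k \<sigma> * real d ^ (k + perm_norm k \<sigma>) * Re (Wg_U \<mu> e k \<sigma>)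
          / real (card (wg_paths k \<sigma> (perm_norm k \<sigma>)))
      \<le> 1 / (1 - 6 * real k powr (7/2) / (real d)^2))"
proof -
  let ?n = "perm_norm k \<sigma>"
  define w where "w = real (catalan_weight k \<sigma>)"
  have w: "w > 0" using catalan_weight_pos by (simp add: w_def)
  have card: "real (card (wg_paths k \<sigma> ?n)) = w"
    using num_paths_perm_norm[OF assms(6)] by (simp add: num_paths_def w_def)
  define A where "A = (\<lambda>g. real (num_paths k \<sigma> (?n + 2 * g)) / real d ^ (2 * g) / w)"
  define s where "s = (-1) ^ ?n * real d ^ (k + ?n) * Re (Wg_U \<mu> e k \<sigma>) / w"
  note W = Wg_U_sums[OF assms(2-6)]
  have A: "A sums s"
    unfolding A_def s_def by (rule sums_divide[OF W(2)])
  have d: "real d > 0" "real d \<ge> 1" "real k \<ge> 1" "real k \<le> real d" using assms(4,5) by auto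
  define q where "q = (real k - 1) / (real d)\<^sup>2"
  \<comment> \<open>The chain k - 1 < d \<le> d^2 makes the minorant converge for every
    \<open>d \<ge> k\<close>; this is why the lower bound carries no size condition.\<close>
  have "real d \<le> (real d)\<^sup>2" using d by (simp add: self_le_power)
  then have "real k - 1 < (real d)\<^sup>2" using d by linarith
  then have q: "0 \<le> q" "q < 1" using d by (auto simp: q_def)
  have "q ^ g \<le> A g" for g
  proof -
    have "real ((k - 1) ^ g * catalan_weight k \<sigma>) \<le> real (num_paths k \<sigma> (?n + 2 * g))"
      using num_paths_ge[OF assms(6,4)] by (simp only: of_nat_le_iff)
    then have "(real k - 1) ^ g * w \<le> real (num_paths k \<sigma> (?n + 2 * g))"
      using assms(4) by (simp add: w_def of_nat_diff)
    then have "(real k - 1) ^ g * w / real d ^ (2 * g) / w \<le> A g"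
      unfolding A_def using d w by (intro divide_right_mono) auto
    then show ?thesis using w by (simp add: q_def power_divide power_mult)
  qed
  then have lower: "1 / (1 - q) \<le> s"
    using A q by (intro sums_le[OF _ geometric_sums]) auto
  have upper: "s \<le> 1 / (1 - 6 * real k powr (7/2) / (real d)\<^sup>2)"
    if "real d > sqrt 6 * real k powr (7/4)"
  proof -
    define r where "r = 6 * real k powr (7/2) / (real d)\<^sup>2"
    \<comment> \<open>Squared, the hypothesis on \<open>d\<close> says exactly that the ratio
      \<open>r\<close> of the majorant is below one.\<close>
    have "(sqrt 6 * real k powr (7/4))\<^sup>2 < (real d)\<^sup>2"
      using that by (intro power_strict_mono) auto
    also have "(sqrt 6 * real k powr (7/4))\<^sup>2 = 6 * real k powr (7/2)"
    proof -
      have "(real k powr (7/4))\<^sup>2 = real k powr (7/2)"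
        unfolding power2_eq_square powr_add[symmetric] by simp
      then show ?thesis by (simp add: power_mult_distrib)
    qed
    finally have r: "0 \<le> r" "r < 1" using d by (auto simp: r_def)
    have "real k powr (7/2) = real k powr (real 3 + 1 / 2)" by simp
    also have "\<dots> = real k * (real k * (real k * sqrt (real k)))"
      using d unfolding powr_add by (subst powr_realpow) (auto simp: powr_half_sqrt power3_eq_cube)
    \<comment> \<open>Counting paths yields 2 k^(7/2), with the 2 coming from k + |\<sigma>| \<le> 2
      k; the constant 6 of the statement is a weakening.\<close>
    finally have k: "2 * real k * (real k * (real k * sqrt (real k))) \<le> 6 * real k powr (7/2)"
      by simp
    have "A g \<le> r ^ g" for g
    proof -
      have "real (num_paths k \<sigma> (?n + 2 * g))
        \<le> (2 * real k * (real k * (real k * sqrt (real k)))) ^ g * w"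
        unfolding w_def by (rule num_paths_le[OF assms(6) order.refl])
      also have "\<dots> \<le> (6 * real k powr (7/2)) ^ g * w"
        using w by (intro mult_right_mono power_mono k) auto
      finally have "A g \<le> (6 * real k powr (7/2)) ^ g * w / real d ^ (2 * g) / w"
        unfolding A_def using d w by (intro divide_right_mono) auto
      then show ?thesis using w by (simp add: r_def power_divide power_mult)
    qed
    then show ?thesis
      using A r unfolding r_def[symmetric] by (intro sums_le[OF _ _ geometric_sums]) auto
  qed
  show ?thesis
    unfolding card using W(1) lower upper by (simp add: s_def q_def)
qed

end
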